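(* Let $e_1,e_2,e_3\in\mathbb{Z}[t]$ and let $E=E(t): y^2=(x-e_1)(x-e_2)(x-e_3)$ be a nonconstant elliptic curve over $\mathbb{Q}(t)$. Let $t_0\in\mathbb{Q}$ be such that the specialization $E(t_0)$ of $E(t)$ is an elliptic curve over $\mathbb{Q}$. Assume that $t_0$ satisfies the following condition: for every nonconstant square-free divisor $h$ in $\mathbb{Z}[t]$ of $(e_1-e_2)(e_1-e_3)$, or of $(e_2-e_1)(e_2-e_3)$, or of $(e_3-e_1)(e_3-e_2)$, the rational number $h(t_0)$ is not a square in $\mathbb{Q}$. Then the specialization homomorphism $\sigma: E(\mathbb{Q}(t))\to E(t_0)(\mathbb{Q})$ is injective.
   Context: An elliptic curve over $\mathbb{Q}(t)$ is nonconstant (non-isotrivial) if it is not isomorphic over $\mathbb{Q}(t)$ to an elliptic curve defined over $\mathbb{Q}$. The specialization $E(t_0)$ is the curve obtained by substituting $t=t_0$ in the coefficients; it is an elliptic curve when $(e_1-e_2)(e_2-e_3)(e_3-e_1)(t_0)\neq 0$. The specialization homomorphism $\sigma=\sigma_{t_0}$ sends a point of $E(\mathbb{Q}(t))$ to the point of $E(t_0)(\mathbb{Q})$ obtained by evaluating its (projective) coordinates at $t=t_0$ (points whose $x$-coordinate has a pole at $t_0$ go to the point at infinity $O$). Divisibility and square-freeness are taken in the UFD $\mathbb{Z}[t]$. *)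

theory Defs
  imports "HOL-Computational_Algebra.Computational_Algebra"
begin

type_synonym rf = "rat poly fract"

datatype 'a ec_point = Infinity | Affine 'a 'a

definition ipoly_to_rf :: "int poly \<Rightarrow> rf" where
  "ipoly_to_rf p = Fract (map_poly of_int p) 1"

definition ipoly_eval :: "int poly \<Rightarrow> rat \<Rightarrow> rat" where
  "ipoly_eval p t0 = poly (map_poly of_int p) t0"

text \<open>f is regular at t0 iff f = p/q with q(t0) \<noteq> 0; then f(t0) = p(t0)/q(t0)
  (independent of the representation). Otherwise f has a pole at t0.\<close>
definition rf_has_pole :: "rf \<Rightarrow> rat \<Rightarrow> bool" where
  "rf_has_pole f t0 \<longleftrightarrow> \<not> (\<exists>p q. poly q t0 \<noteq> 0 \<and> f = Fract p q)"

definition rf_eval :: "rf \<Rightarrow> rat \<Rightarrow> rat" where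
  "rf_eval f t0 = (SOME v. \<exists>p q. poly q t0 \<noteq> 0 \<and> f = Fract p q \<and> v = poly p t0 / poly q t0)"

definition legendre_points :: "'a::field \<Rightarrow> 'a \<Rightarrow> 'a \<Rightarrow> 'a ec_point set" where
  "legendre_points a b c =
     insert Infinity {Affine x y | x y. y^2 = (x - a) * (x - b) * (x - c)}"

fun specialize :: "rat \<Rightarrow> rf ec_point \<Rightarrow> rat ec_point" where
  "specialize t0 Infinity = Infinity"
| "specialize t0 (Affine x y) =
     (if rf_has_pole x t0 then Infinity else Affine (rf_eval x t0) (rf_eval y t0))"

text \<open>Discriminant of a general Weierstrass equation
  y^2 + a1 xy + a3 y = x^3 + a2 x^2 + a4 x + a6.\<close>
definition weierstrass_disc :: "'a::comm_ring_1 \<Rightarrow> 'a \<Rightarrow> 'a \<Rightarrow> 'a \<Rightarrow> 'a \<Rightarrow> 'a" where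
  "weierstrass_disc a1 a2 a3 a4 a6 =
    (let b2 = a1^2 + 4*a2; b4 = 2*a4 + a1*a3; b6 = a3^2 + 4*a6;
         b8 = a1^2*a6 + 4*a2*a6 - a1*a3*a4 + a2*a3^2 - a4^2
     in -(b2^2*b8) - 8*b4^3 - 27*b6^2 + 9*b2*b4*b6)"

text \<open>Isomorphism of Weierstrass equations over a field (Silverman III.1):
  the change of variables x = u^2 x' + r, y = u^3 y' + u^2 s x' + w (u \<noteq> 0)
  transforms (a1,...,a6) into (a1',...,a6').\<close>
definition weierstrass_iso ::
  "'a::field \<Rightarrow> 'a \<Rightarrow> 'a \<Rightarrow> 'a \<Rightarrow> 'a \<Rightarrow> 'a \<Rightarrow> 'a \<Rightarrow> 'a \<Rightarrow> 'a \<Rightarrow> 'a \<Rightarrow> bool" where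
  "weierstrass_iso a1 a2 a3 a4 a6 a1' a2' a3' a4' a6' \<longleftrightarrow>
    (\<exists>u r s w. u \<noteq> 0 \<and>
       u * a1' = a1 + 2*s \<and>
       u^2 * a2' = a2 - s*a1 + 3*r - s^2 \<and>
       u^3 * a3' = a3 + r*a1 + 2*w \<and>
       u^4 * a4' = a4 - s*a3 + 2*r*a2 - (w + r*s)*a1 + 3*r^2 - 2*s*w \<and>
       u^6 * a6' = a6 + r*a4 + r^2*a2 + r^3 - w*a3 - w^2 - r*w*a1)"

definition legendre_constant :: "int poly \<Rightarrow> int poly \<Rightarrow> int poly \<Rightarrow> bool" where
  "legendre_constant e1 e2 e3 \<longleftrightarrow>
    (let E1 = ipoly_to_rf e1; E2 = ipoly_to_rf e2; E3 = ipoly_to_rf e3 in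
     \<exists>b1 b2 b3 b4 b6 :: rat. weierstrass_disc b1 b2 b3 b4 b6 \<noteq> 0 \<and>
       weierstrass_iso 0 (-(E1+E2+E3)) 0 (E1*E2 + E1*E3 + E2*E3) (-(E1*E2*E3))
         (of_rat b1) (of_rat b2) (of_rat b3) (of_rat b4) (of_rat b6))"

end

theory Submission
  imports Defs
begin

text \<open>If two distinct points have the same specialization at \<open>t\<^sub>0\<close>, their difference is a
  point whose \<open>x\<close>-coordinate has a pole at \<open>t\<^sub>0\<close>. For such a point the hypothesis on square-free
  divisors makes all \<open>x - e\<^sub>i\<close> squares in \<open>\<rat>(t)\<close>, so the point is the double of another one,
  which can again be chosen with a pole at \<open>t\<^sub>0\<close>. The point is therefore infinitely 2-divisible,
  and so are its specializations at all other rational \<open>t\<^sub>1\<close> with good fibre; by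
  the height inequality for doubling over \<open>\<rat>\<close> these are periodic under doubling. But if
  \<open>t\<^sub>1\<close> is 2-adically close to \<open>t\<^sub>0\<close>, the specialization at \<open>t\<^sub>1\<close> has a 2-adic pole whose order
  strictly increases under doubling.\<close>

section \<open>The local ring of rational functions at a point\<close>

text \<open>\<open>rf_eval\<close> picks an arbitrary admissible fraction; cross-multiplying two of
  them and evaluating at \<open>t\<close> shows that all give the same value.\<close>

lemma rf_eval_Fract:
  assumes "poly q t \<noteq> 0"
  shows "rf_eval (Fract p q) t = poly p t / poly q t"
  unfolding rf_eval_def
proof (rule some_equality)
  show "\<exists>p' q'. poly q' t \<noteq> 0 \<and> Fract p q = Fract p' q' \<and>
          poly p t / poly q t = poly p' t / poly q' t"
    using assms by blast
next
  fix v assume "\<exists>p' q'. poly q' t \<noteq> 0 \<and> Fract p q = Fract p' q' \<and> v = poly p' t / poly q' t"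
  then obtain p' q' where *: "poly q' t \<noteq> 0" "Fract p q = Fract p' q'" "v = poly p' t / poly q' t"
    by blast
  have "q \<noteq> 0" "q' \<noteq> 0" using assms * by auto
  with * have "p * q' = p' * q" by (simp add: eq_fract)
  then have "poly p t * poly q' t = poly p' t * poly q t" by (metis poly_mult)
  with * assms show "v = poly p t / poly q t" by (simp add: frac_eq_eq)
qed

lemma rf_regularI: "poly q t \<noteq> 0 \<Longrightarrow> \<not> rf_has_pole (Fract p q) t"
  unfolding rf_has_pole_def by blast

lemma rf_regularE:
  assumes "\<not> rf_has_pole f t"
  obtains p q where "poly q t \<noteq> 0" "f = Fract p q" "rf_eval f t = poly p t / poly q t"
  using assms rf_eval_Fract unfolding rf_has_pole_def by metis

lemma rf_regular_add:
  assumes "\<not> rf_has_pole f t" "\<not> rf_has_pole g t"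
  shows "\<not> rf_has_pole (f + g) t" "rf_eval (f + g) t = rf_eval f t + rf_eval g t"
proof -
  obtain p q where f: "poly q t \<noteq> 0" "f = Fract p q" "rf_eval f t = poly p t / poly q t"
    using assms(1) by (rule rf_regularE)
  obtain r s where g: "poly s t \<noteq> 0" "g = Fract r s" "rf_eval g t = poly r t / poly s t"
    using assms(2) by (rule rf_regularE)
  have "q \<noteq> 0" "s \<noteq> 0" using f g by auto
  then have fg: "f + g = Fract (p * s + r * q) (q * s)" using f g by simp
  show "\<not> rf_has_pole (f + g) t"
    unfolding fg using f g by (intro rf_regularI) simp
  show "rf_eval (f + g) t = rf_eval f t + rf_eval g t"
    unfolding fg using f g by (subst rf_eval_Fract) (auto simp: field_simps)
qed

lemma rf_regular_mult:
  assumes "\<not> rf_has_pole f t" "\<not> rf_has_pole g t"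
  shows "\<not> rf_has_pole (f * g) t" "rf_eval (f * g) t = rf_eval f t * rf_eval g t"
proof -
  obtain p q where f: "poly q t \<noteq> 0" "f = Fract p q" "rf_eval f t = poly p t / poly q t"
    using assms(1) by (rule rf_regularE)
  obtain r s where g: "poly s t \<noteq> 0" "g = Fract r s" "rf_eval g t = poly r t / poly s t"
    using assms(2) by (rule rf_regularE)
  have fg: "f * g = Fract (p * r) (q * s)" using f g by simp
  show "\<not> rf_has_pole (f * g) t"
    unfolding fg using f g by (intro rf_regularI) simp
  show "rf_eval (f * g) t = rf_eval f t * rf_eval g t"
    unfolding fg using f g by (subst rf_eval_Fract) auto
qed

lemma rf_regular_const: "\<not> rf_has_pole (Fract [:c:] 1) t" "rf_eval (Fract [:c:] 1) t = c"
  by (rule rf_regularI, simp) (simp add: rf_eval_Fract)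

lemma rf_regular_1: "\<not> rf_has_pole 1 t" "rf_eval 1 t = 1"
  using rf_regular_const[of 1 t] by (simp_all add: One_fract_def flip: one_pCons)

lemma rf_regular_uminus:
  assumes "\<not> rf_has_pole f t"
  shows "\<not> rf_has_pole (- f) t" "rf_eval (- f) t = - rf_eval f t"
proof -
  obtain p q where f: "poly q t \<noteq> 0" "f = Fract p q" "rf_eval f t = poly p t / poly q t"
    using assms by (rule rf_regularE)
  show "\<not> rf_has_pole (- f) t" using f rf_regularI[of q t "-p"] by simp
  show "rf_eval (- f) t = - rf_eval f t" using f rf_eval_Fract[of q t "-p"] by simp
qed

lemma rf_regular_diff:
  assumes "\<not> rf_has_pole f t" "\<not> rf_has_pole g t"
  shows "\<not> rf_has_pole (f - g) t" "rf_eval (f - g) t = rf_eval f t - rf_eval g t"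
  using rf_regular_add[OF assms(1) rf_regular_uminus(1)[OF assms(2)]]
    rf_regular_uminus[OF assms(2)] by simp_all

lemma rf_regular_power:
  assumes "\<not> rf_has_pole f t"
  shows "\<not> rf_has_pole (f ^ n) t \<and> rf_eval (f ^ n) t = rf_eval f t ^ n"
  using assms by (induction n) (simp_all add: rf_regular_1 rf_regular_mult)

lemma rf_regular_power2:
  assumes "\<not> rf_has_pole f t"
  shows "\<not> rf_has_pole (f\<^sup>2) t" "rf_eval (f\<^sup>2) t = (rf_eval f t)\<^sup>2"
  using rf_regular_power[OF assms] by blast+

lemma rf_regular_numeral: "\<not> rf_has_pole (numeral n) t" "rf_eval (numeral n) t = numeral n"
proof -
  have "(numeral n :: rf) = Fract [:numeral n:] 1"
    by (metis Fract_of_nat_eq of_nat_numeral numeral_poly)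
  then show "\<not> rf_has_pole (numeral n) t" "rf_eval (numeral n) t = numeral n"
    by (simp_all only: rf_regular_const not_False_eq_True)
qed

lemma rf_regular_inverse:
  assumes "\<not> rf_has_pole f t" "rf_eval f t \<noteq> 0"
  shows "\<not> rf_has_pole (inverse f) t" "rf_eval (inverse f) t = inverse (rf_eval f t)"
proof -
  obtain p q where f: "poly q t \<noteq> 0" "f = Fract p q" "rf_eval f t = poly p t / poly q t"
    using assms(1) by (rule rf_regularE)
  have p: "poly p t \<noteq> 0" using f assms(2) by auto
  show "\<not> rf_has_pole (inverse f) t" using f p by (simp add: rf_regularI)
  show "rf_eval (inverse f) t = inverse (rf_eval f t)" using f p by (simp add: rf_eval_Fract)
qed

text \<open>The functions regular at \<open>t\<close> form a valuation ring. Powers of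
  \<open>w\<close>, the linear polynomial vanishing at \<open>t\<close>, are split off numerator and
  denominator. If the numerator had at least the order of the denominator, cancelling would give a
  regular fraction; so the inverse keeps a positive power of \<open>w\<close> in its
  numerator.\<close>

lemma rf_pole_inverse:
  assumes "rf_has_pole f t"
  shows "f \<noteq> 0" "\<not> rf_has_pole (inverse f) t" "rf_eval (inverse f) t = 0"
proof -
  obtain p q where f: "f = Fract p q" and q: "q \<noteq> 0" by (cases f)
  show f0: "f \<noteq> 0" using assms rf_regularI[of 1 t 0] by (auto simp: Zero_fract_def)
  then have p: "p \<noteq> 0" using f q by (auto simp: Zero_fract_def eq_fract)
  define w where "w = [:-t, 1:]"
  obtain p' where p': "p = w ^ order t p * p'" "\<not> w dvd p'"
    using order_decomp[OF p] unfolding w_def by blast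
  obtain q' where q': "q = w ^ order t q * q'" "\<not> w dvd q'"
    using order_decomp[OF q] unfolding w_def by blast
  have nz: "poly p' t \<noteq> 0" "poly q' t \<noteq> 0"
    using p' q' by (simp_all add: w_def poly_eq_0_iff_dvd)
  then have nz': "p' \<noteq> 0" "q' \<noteq> 0" "w \<noteq> 0" by (auto simp: w_def)
  have lt: "order t p < order t q"
  proof (rule ccontr)
    assume "\<not> order t p < order t q"
    then have "w ^ order t p = w ^ (order t p - order t q) * w ^ order t q"
      by (simp flip: power_add)
    then have "p = w ^ (order t p - order t q) * w ^ order t q * p'" using p' by metis
    then have "p * q' = (w ^ (order t p - order t q) * p') * q"
      by (subst (2) q'(1)) (simp add: ac_simps)
    then have "f = Fract (w ^ (order t p - order t q) * p') q'"
      using f q nz' by (simp add: eq_fract)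
    then show False using assms rf_regularI nz by blast
  qed
  then have "w ^ order t q = w ^ (order t q - order t p) * w ^ order t p"
    by (simp flip: power_add)
  then have "q = w ^ (order t q - order t p) * w ^ order t p * q'" using q' by metis
  then have "q * p' = (w ^ (order t q - order t p) * q') * p"
    by (subst (2) p'(1)) (simp add: ac_simps)
  then have "inverse f = Fract (w ^ (order t q - order t p) * q') p'"
    using f p nz' by (simp add: eq_fract)
  moreover have "poly (w ^ (order t q - order t p) * q') t = 0"
    using lt by (simp add: w_def)
  ultimately show "\<not> rf_has_pole (inverse f) t" "rf_eval (inverse f) t = 0"
    using nz by (simp_all only: rf_regularI rf_eval_Fract not_False_eq_True div_0)
qed

lemmas rf_regular_simps =
  rf_regular_add rf_regular_mult rf_regular_diff rf_regular_uminus rf_regular_power2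
  rf_regular_1 rf_regular_numeral

section \<open>Two-descent at a pole\<close>

lemma map_poly_of_int_simps:
  fixes p q :: "int poly"
  shows "map_poly of_int (p + q) = (map_poly of_int p + map_poly of_int q :: rat poly)"
    "map_poly of_int (p * q) = (map_poly of_int p * map_poly of_int q :: rat poly)"
    "map_poly of_int (p - q) = (map_poly of_int p - map_poly of_int q :: rat poly)"
  by (rule poly_eqI, simp add: coeff_map_poly coeff_mult)+

lemma map_poly_of_int_inj: "map_poly of_int p = (map_poly of_int q :: rat poly) \<longleftrightarrow> p = q"
  by (simp add: poly_eq_iff coeff_map_poly)

lemma ipoly_to_rf_simps:
  "ipoly_to_rf (p + q) = ipoly_to_rf p + ipoly_to_rf q"
  "ipoly_to_rf (p - q) = ipoly_to_rf p - ipoly_to_rf q"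
  "ipoly_to_rf (p * q) = ipoly_to_rf p * ipoly_to_rf q"
  by (simp_all add: ipoly_to_rf_def map_poly_of_int_simps)

lemma ipoly_to_rf_power2: "ipoly_to_rf (p\<^sup>2) = (ipoly_to_rf p)\<^sup>2"
  by (simp add: power2_eq_square ipoly_to_rf_simps)

lemma ipoly_to_rf_eq_iff [simp]: "ipoly_to_rf p = ipoly_to_rf q \<longleftrightarrow> p = q"
  by (simp add: ipoly_to_rf_def eq_fract map_poly_of_int_inj)

lemma ipoly_to_rf_0 [simp]: "ipoly_to_rf 0 = 0"
  by (simp add: ipoly_to_rf_def Zero_fract_def)

lemma ipoly_to_rf_eq_0_iff [simp]: "ipoly_to_rf p = 0 \<longleftrightarrow> p = 0"
  using ipoly_to_rf_eq_iff[of p 0] by simp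

lemma ipoly_eval_simps:
  "ipoly_eval (p + q) t = ipoly_eval p t + ipoly_eval q t"
  "ipoly_eval (p - q) t = ipoly_eval p t - ipoly_eval q t"
  "ipoly_eval (p * q) t = ipoly_eval p t * ipoly_eval q t"
  by (simp_all add: ipoly_eval_def map_poly_of_int_simps)

lemma rf_regular_ipoly:
  "\<not> rf_has_pole (ipoly_to_rf p) t" "rf_eval (ipoly_to_rf p) t = ipoly_eval p t"
  by (simp_all add: ipoly_to_rf_def ipoly_eval_def rf_regularI rf_eval_Fract)

lemma rat_poly_clear_denominators:
  fixes p :: "rat poly"
  shows "\<exists>n::int. n > 0 \<and> (\<exists>P::int poly. smult (of_int n) p = map_poly of_int P)"
proof (induction p)
  case 0
  then show ?case by (intro exI[of _ 1]) (auto intro: exI[of _ 0])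
next
  case (pCons c p)
  then obtain n P where n: "n > 0" "smult (of_int n) p = map_poly of_int P" by blast
  obtain a b :: int where c: "c = of_int a / of_int b" "b > 0"
    by (metis quotient_of_div quotient_of_denom_pos surj_pair)
  have "smult (of_int (b * n)) (pCons c p) = map_poly of_int (pCons (n * a) (smult b P))"
  proof -
    have "smult (of_int b) (smult (of_int n) p) = map_poly of_int (smult b P)"
      unfolding n by (rule poly_eqI) (simp add: coeff_map_poly)
    then show ?thesis using c by (simp add: map_poly_pCons)
  qed
  then show ?case using n c by (intro exI[of _ "b * n"]) auto
qed

text \<open>The gcd is removed in Z[t], together with common integer factors. The descent needs
  coprimality there, because the divisors in the hypothesis live in Z[t].\<close>

lemma rf_coprime_ipoly_fraction:
  obtains A B :: "int poly" where "B \<noteq> 0" "coprime A B" "f = ipoly_to_rf A / ipoly_to_rf B"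
proof -
  obtain p q where f: "f = Fract p q" "q \<noteq> 0" by (cases f)
  obtain m P where m: "m > 0" "smult (of_int m) p = map_poly of_int (P :: int poly)"
    using rat_poly_clear_denominators by blast
  obtain n Q where n: "n > 0" "smult (of_int n) q = map_poly of_int (Q :: int poly)"
    using rat_poly_clear_denominators by blast
  have P: "map_poly of_int (smult n P) = smult (of_int (n * m)) p"
    and Q: "map_poly of_int (smult m Q) = smult (of_int (n * m)) q"
    using arg_cong[OF m(2), of coeff] arg_cong[OF n(2), of coeff]
    by (auto intro!: poly_eqI simp: coeff_map_poly fun_eq_iff)
  have nz: "smult m Q \<noteq> 0"
  proof
    assume "smult m Q = 0"
    then have "smult (of_int (n * m)) q = 0" using Q by (metis map_poly_0)
    then show False using f m n by simp
  qed
  have eq: "f = ipoly_to_rf (smult n P) / ipoly_to_rf (smult m Q)"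
    unfolding ipoly_to_rf_def P Q f using f m n by (simp add: eq_fract)
  define d where "d = gcd (smult n P) (smult m Q)"
  have d: "d \<noteq> 0" using nz by (simp add: d_def)
  obtain A B where AB: "smult n P = A * d" "smult m Q = B * d" "coprime A B"
    using gcd_coprime_exists[of "smult n P" "smult m Q"] d unfolding d_def by metis
  show ?thesis
  proof (rule that[of B A])
    show "B \<noteq> 0" using AB nz by auto
    show "f = ipoly_to_rf A / ipoly_to_rf B"
      unfolding eq AB using d by (simp add: ipoly_to_rf_simps)
  qed (use AB in auto)
qed

text \<open>With \<open>g = gcd h z\<close>, the cofactor \<open>h'\<close> of \<open>g\<close> in
  \<open>h\<close> is coprime to \<open>z'\<close> and hence divides \<open>g\<close>; so
  \<open>h'^2\<close> divides \<open>h\<close>, and \<open>h'\<close> is a unit.\<close>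

lemma squarefree_dvd_if_mult_eq_square:
  fixes h :: "'a :: factorial_ring_gcd"
  assumes "squarefree h" "h * m = z\<^sup>2"
  shows "h dvd z"
proof -
  have h: "h \<noteq> 0" using assms(1) by auto
  define g where "g = gcd h z"
  have g: "g \<noteq> 0" using h by (simp add: g_def)
  obtain h' z' where hz: "h = h' * g" "z = z' * g" "coprime h' z'"
    using gcd_coprime_exists[of h z] g unfolding g_def by metis
  have "h' * m * g = (z'\<^sup>2 * g) * g" using assms(2) hz by (simp add: power2_eq_square ac_simps)
  then have "h' * m = z'\<^sup>2 * g" using g by simp
  then have "h' dvd z'\<^sup>2 * g" by (metis dvd_triv_left)
  moreover have "coprime h' (z'\<^sup>2)" using hz by simp
  ultimately have "h' dvd g" by (simp add: coprime_dvd_mult_right_iff)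
  then have "h'\<^sup>2 dvd h" using hz by (simp add: power2_eq_square)
  then have "is_unit h'" using assms(1) by (rule squarefreeD[rotated])
  then have "h dvd g" using hz by (simp add: mult_unit_dvd_iff')
  then show ?thesis unfolding g_def by (meson dvd_trans gcd_dvd2)
qed

text \<open>If \<open>f\<close> had a pole, the regular functions \<open>f^2\<close> and
  \<open>(inverse f)^2\<close> would have product 1, although the second one has value 0.\<close>

lemma rf_regular_sqrt:
  assumes "\<not> rf_has_pole (f\<^sup>2) t"
  shows "\<not> rf_has_pole f t"
proof
  assume p: "rf_has_pole f t"
  note i = rf_pole_inverse[OF p]
  have "rf_eval (f\<^sup>2 * (inverse f)\<^sup>2) t = rf_eval (f\<^sup>2) t * 0"
    using assms i by (simp add: rf_regular_simps)
  moreover have "f\<^sup>2 * (inverse f)\<^sup>2 = 1" using i by (simp add: field_simps)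
  ultimately show False by (simp add: rf_regular_1)
qed

lemma rf_pole_mult:
  assumes f: "rf_has_pole f t" and g: "rf_has_pole g t"
  shows "rf_has_pole (f * g) t"
proof (rule ccontr)
  assume r: "\<not> rf_has_pole (f * g) t"
  note i = rf_pole_inverse[OF f] and j = rf_pole_inverse[OF g]
  have "rf_eval ((f * g) * (inverse f * inverse g)) t = 0"
    using r i j by (simp add: rf_regular_simps)
  moreover have "(f * g) * (inverse f * inverse g) = 1" using i j by (simp add: field_simps)
  ultimately show False by (simp add: rf_regular_1)
qed

lemma rf_pole_diff_ipoly: "rf_has_pole (f - ipoly_to_rf e) t \<longleftrightarrow> rf_has_pole f t"
  using rf_regular_diff(1)[of f t "ipoly_to_rf e"]
    rf_regular_add(1)[of "f - ipoly_to_rf e" t "ipoly_to_rf e"] rf_regular_ipoly(1)[of e t]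
  by auto

text \<open>This is how poles are produced from equations: for a regular \<open>f\<close> the left
  side would vanish at \<open>t\<close>, but the right side does not.\<close>

lemma rf_pole_if_inverse_eval_0:
  assumes "\<not> rf_has_pole g t" "rf_eval g t = 0" "\<not> rf_has_pole h t" "rf_eval h t \<noteq> 0" "f * g = h"
  shows "rf_has_pole f t"
  using assms rf_regular_mult(2)[of f t g] by auto

text \<open>The cleared equation carries one extra factor \<open>B\<close>: the left side becomes
  the square of \<open>C * B^2\<close>, and on the right appears \<open>A * B\<close>, which lies in
  the square class of \<open>A / B\<close>.\<close>

lemma legendre_clear_denominators:
  fixes A B C D a b :: "'a :: field"
  assumes "B \<noteq> 0" "D \<noteq> 0" "(C / D)\<^sup>2 = A / B * (A / B - a) * (A / B - b)"
  shows "C\<^sup>2 * B\<^sup>2 * B\<^sup>2 = A * B * (A - a * B) * (A - b * B) * D\<^sup>2"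
proof -
  have "A / B - a = (A - a * B) / B" "A / B - b = (A - b * B) / B"
    using assms by (simp_all add: diff_divide_distrib)
  with assms have "C\<^sup>2 / D\<^sup>2 = A * (A - a * B) * (A - b * B) / (B * B * B)"
    by (simp add: power_divide)
  then have "C\<^sup>2 * (B * B * B) = A * (A - a * B) * (A - b * B) * D\<^sup>2"
    using assms by (simp add: frac_eq_eq)
  then have "C\<^sup>2 * (B * B * B) * B = A * (A - a * B) * (A - b * B) * D\<^sup>2 * B" by simp
  then show ?thesis by (simp add: power2_eq_square ac_simps)
qed

text \<open>Two-descent: the square class of \<open>X\<close> is represented by a square-free divisor of
  \<open>a * b\<close>. Near a pole \<open>(X - a) (X - b)\<close> is \<open>X\<^sup>2\<close> times a unit with value 1,
  so the value of that divisor at \<open>t\<close> is a rational square.\<close>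
lemma square_if_pole:
  fixes a b :: "int poly"
  assumes curve: "y\<^sup>2 = X * (X - ipoly_to_rf a) * (X - ipoly_to_rf b)"
    and pole: "rf_has_pole X t"
    and nz: "ipoly_eval a t \<noteq> 0" "ipoly_eval b t \<noteq> 0"
    and cond: "\<And>h. squarefree h \<Longrightarrow> degree h > 0 \<Longrightarrow> h dvd a * b \<Longrightarrow>
                 \<not> (\<exists>q::rat. q\<^sup>2 = ipoly_eval h t)"
  shows "\<exists>r. X = r\<^sup>2"
proof -
  let ?I = ipoly_to_rf
  obtain A B where B: "B \<noteq> 0" and cop: "coprime A B" and X: "X = ?I A / ?I B"
    by (rule rf_coprime_ipoly_fraction)
  obtain C D where D: "D \<noteq> 0" and y: "y = ?I C / ?I D"
    by (rule rf_coprime_ipoly_fraction)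
  note inv = rf_pole_inverse[OF pole]
  have A: "A \<noteq> 0" using inv(1) X by auto
  \<comment> \<open>\<open>h\<close> is the square-free representative of the square class of
    \<open>X\<close>, since \<open>A / B = h * (s / B)^2\<close>.\<close>
  define h s M where "h = squarefree_part (A * B)" and "s = square_part (A * B)"
    and "M = (A - a * B) * (A - b * B)"
  have AB: "A * B = h * s\<^sup>2" unfolding h_def s_def by (rule squarefree_decompose)
  have h: "squarefree h" using A B by (simp add: h_def)
  have s: "s \<noteq> 0" and h0: "h \<noteq> 0" using AB A B by auto
  have "?I (h * s\<^sup>2 * M * D\<^sup>2) = ?I ((C * B\<^sup>2)\<^sup>2)"
  proof -
    have "(?I C / ?I D)\<^sup>2 = ?I A / ?I B * (?I A / ?I B - ?I a) * (?I A / ?I B - ?I b)"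
      using curve unfolding X y .
    then have "(?I C)\<^sup>2 * (?I B)\<^sup>2 * (?I B)\<^sup>2 =
        ?I A * ?I B * (?I A - ?I a * ?I B) * (?I A - ?I b * ?I B) * (?I D)\<^sup>2"
      using B D by (intro legendre_clear_denominators) simp_all
    from this[symmetric] show ?thesis
      unfolding AB[symmetric] M_def
      by (simp add: ipoly_to_rf_simps ipoly_to_rf_power2 power2_eq_square ac_simps)
  qed
  then have eq: "h * M * (s * D)\<^sup>2 = (C * B\<^sup>2)\<^sup>2" by (simp add: power2_eq_square ac_simps)
  then have "(s * D)\<^sup>2 dvd (C * B\<^sup>2)\<^sup>2" by (metis dvd_triv_right)
  then have "s * D dvd C * B\<^sup>2" by simp
  then obtain w where w: "C * B\<^sup>2 = s * D * w" by blast
  have "h * M * (s * D)\<^sup>2 = w\<^sup>2 * (s * D)\<^sup>2" using eq w by (simp add: power_mult_distrib)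
  then have hM: "h * M = w\<^sup>2" using s D by simp
  have "h dvd w" using squarefree_dvd_if_mult_eq_square[OF h hM] .
  then obtain z where z: "w = h * z" by blast
  have M: "M = h * z\<^sup>2"
    using hM h0 unfolding z by (simp add: power2_eq_square ac_simps)
  have hAB: "h dvd A * B" using AB by simp
  \<comment> \<open>\<open>h\<close> divides \<open>M\<close> and the middle term, hence
    \<open>A^2 + a * b * B^2\<close>. Coprimality of \<open>A\<close> and \<open>B\<close> then
    makes \<open>h\<close> coprime to \<open>B\<close>, so \<open>h\<close> divides \<open>A\<close>
    and finally \<open>a * b\<close>.\<close>
  have MA: "M = A\<^sup>2 - (a + b) * (A * B) + a * b * B\<^sup>2"
    unfolding M_def by (simp add: algebra_simps power2_eq_square)
  have hsum: "h dvd A\<^sup>2 + a * b * B\<^sup>2"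
  proof -
    have "A\<^sup>2 + a * b * B\<^sup>2 = M + (a + b) * (A * B)" using MA by simp
    then show ?thesis using M hAB by simp
  qed
  have hB: "coprime h B"
  proof (rule coprimeI)
    fix c assume c: "c dvd h" "c dvd B"
    then have "c dvd a * b * B\<^sup>2" by (simp add: power2_eq_square)
    then have "c dvd A\<^sup>2" using dvd_trans[OF c(1) hsum] by (simp add: dvd_add_left_iff)
    moreover have "coprime (A\<^sup>2) B" using cop by simp
    ultimately show "is_unit c" using c(2) coprime_common_divisor by blast
  qed
  then have "h dvd A" using hAB by (simp add: coprime_dvd_mult_left_iff)
  then have "h dvd A\<^sup>2" by (simp add: power2_eq_square)
  then have "h dvd a * b * B\<^sup>2" using hsum by (simp add: dvd_add_right_iff)
  moreover have "coprime h (B\<^sup>2)" using hB by simp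
  ultimately have hab: "h dvd a * b" by (simp add: coprime_dvd_mult_left_iff)
  have ht: "ipoly_eval h t \<noteq> 0"
  proof -
    obtain k where "a * b = h * k" using hab by blast
    then have "ipoly_eval a t * ipoly_eval b t = ipoly_eval h t * ipoly_eval k t"
      by (metis ipoly_eval_simps(3))
    then show ?thesis using nz by auto
  qed
  define u where "u = (1 - ?I a * inverse X) * (1 - ?I b * inverse X)"
  have u: "\<not> rf_has_pole u t" "rf_eval u t = 1"
    unfolding u_def using inv by (simp_all add: rf_regular_simps rf_regular_ipoly)
  \<comment> \<open>Dividing \<open>M = h * z^2\<close> by \<open>A^2\<close> gives \<open>u\<close>
    on the left and \<open>h * g^2\<close> on the right.\<close>
  define g where "g = ?I z / ?I A"
  have hg: "?I h * g\<^sup>2 = u"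
  proof -
    have "?I M = ?I h * (?I z)\<^sup>2" unfolding M by (simp add: ipoly_to_rf_simps ipoly_to_rf_power2)
    then have "(?I A - ?I a * ?I B) * (?I A - ?I b * ?I B) = ?I h * (?I z)\<^sup>2"
      unfolding M_def by (simp add: ipoly_to_rf_simps)
    then show ?thesis unfolding g_def u_def X using A B by (simp add: field_simps power2_eq_square)
  qed
  have "g\<^sup>2 = inverse (?I h) * u" using hg h0 by (simp add: field_simps)
  then have "\<not> rf_has_pole (g\<^sup>2) t"
    using u ht by (simp add: rf_regular_mult rf_regular_inverse rf_regular_ipoly)
  then have g: "\<not> rf_has_pole g t" by (rule rf_regular_sqrt)
  have "rf_eval (?I h * g\<^sup>2) t = 1" using hg u by simp
  then have hq: "ipoly_eval h t * (rf_eval g t)\<^sup>2 = 1" using g by (simp add: rf_regular_simps rf_regular_ipoly)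
  define q where "q = inverse (rf_eval g t)"
  have q: "q\<^sup>2 = ipoly_eval h t"
    using hq unfolding q_def by (simp add: power_inverse inverse_unique mult.commute)
  \<comment> \<open>The value of \<open>h\<close> at \<open>t\<close> is a square, so the hypothesis
    leaves only constants. A constant is its own value, hence \<open>h\<close> is the square of the
    rational \<open>q\<close>, and \<open>X = h * (s / B)^2\<close> is a square.\<close>
  have "degree h = 0" using cond[OF h _ hab] q by auto
  then obtain c where c: "h = [:c:]" by (rule degree_eq_zeroE)
  have "?I h = (Fract [:q:] 1)\<^sup>2"
    using q unfolding c by (simp add: ipoly_to_rf_def ipoly_eval_def map_poly_pCons power2_eq_square)
  moreover have "X = ?I h * (?I s / ?I B)\<^sup>2"
  proof -
    have "?I A * ?I B = ?I h * (?I s)\<^sup>2"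
      using AB by (metis ipoly_to_rf_simps(3) ipoly_to_rf_power2)
    then show ?thesis unfolding X using B by (simp add: field_simps power2_eq_square)
  qed
  ultimately have "X = (Fract [:q:] 1 * (?I s / ?I B))\<^sup>2" by (simp only: power_mult_distrib)
  then show ?thesis by blast
qed

section \<open>Heights and 2-adic poles under doubling over the rationals\<close>

text \<open>The \<open>x\<close>-coordinate of \<open>2P\<close> on \<open>y\<^sup>2 = x (x - a) (x - b)\<close>.\<close>
definition legendre_double :: "'a::field \<Rightarrow> 'a \<Rightarrow> 'a \<Rightarrow> 'a" where
  "legendre_double a b x = (x\<^sup>2 - a * b)\<^sup>2 / (4 * x * (x - a) * (x - b))"

text \<open>This is the multiplicative Weil height, since \<open>quotient_of\<close> returns lowest
  terms; only finitely many rationals lie below a bound (Northcott).\<close>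

definition rat_height :: "rat \<Rightarrow> int" where
  "rat_height x = max \<bar>fst (quotient_of x)\<bar> \<bar>snd (quotient_of x)\<bar>"

lemma rat_height_pos: "rat_height x \<ge> 1"
  using quotient_of_denom_pos'[of x] by (simp add: rat_height_def)

lemma finite_rat_height_le: "finite {x. rat_height x \<le> B}"
proof (rule finite_subset)
  show "{x. rat_height x \<le> B} \<subseteq> (\<lambda>(p, q). of_int p / of_int q) ` ({-B..B} \<times> {-B..B})"
  proof safe
    fix x assume "rat_height x \<le> B"
    then show "x \<in> (\<lambda>(p, q). of_int p / of_int q) ` ({-B..B} \<times> {-B..B})"
      using quotient_of_div[of x "fst (quotient_of x)" "snd (quotient_of x)"]
      by (intro image_eqI[of _ _ "quotient_of x"]) (auto simp: rat_height_def case_prod_unfold mem_Times_iff)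
  qed
qed simp

text \<open>The two quartic forms are numerator and denominator of the duplication map. They have no
  common projective zero, so together they control the fourth power of the height: the first form
  suffices when \<open>p\<close> is large against \<open>q\<close>, and otherwise \<open>p\<close>
  is eliminated.\<close>

lemma double_forms_lower_bound:
  fixes a b :: int
  assumes "a \<noteq> 0" "b \<noteq> 0" "a \<noteq> b"
  shows "\<exists>K\<ge>0. \<forall>p q. (max \<bar>p\<bar> \<bar>q\<bar>) ^ 4 \<le>
     K * ((p\<^sup>2 - a * b * q\<^sup>2)\<^sup>2 + \<bar>4 * p * q * (p - a * q) * (p - b * q)\<bar>)"
proof -
  define c where "c = a * b"
  define G s where "G = \<bar>c\<bar>" and "s = \<bar>a + b\<bar>"
  \<comment> \<open>For \<open>|p| <= 2 * G * |q|\<close> these constants will bound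
    \<open>|U|\<close> by \<open>K1 * q^2\<close> and \<open>|L|\<close> by \<open>K2 * |q|\<close>.
    In \<open>K\<close>, the summand 4 serves the case of large \<open>p\<close> and the other
    summand the remaining case.\<close>
  define K1 K2 where "K1 = 4 * G + (2 * G + s) * (4 * G + s)" and "K2 = 4 * G + s"
  define K where "K = 4 + 16 * G ^ 4 * (16 * K1\<^sup>2 + 2 * K2)"
  have G1: "G \<ge> 1" using assms by (simp add: G_def c_def abs_mult) (smt (verit) mult_le_0_iff zero_less_mult_iff)
  have s0: "s \<ge> 0" by (simp add: s_def)
  have K1: "K1 \<ge> 0" and K2: "K2 \<ge> 0" using G1 s0 by (simp_all add: K1_def K2_def)
  have K16: "16 * G ^ 4 * (16 * K1\<^sup>2 + 2 * K2) \<ge> 0" using K2 G1 by simp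
  show ?thesis
  proof (intro exI[of _ K] conjI allI)
    show "K \<ge> 0" using K16 by (simp add: K_def)
    fix p q :: int
    define F M where "F = p\<^sup>2 - c * q\<^sup>2" and "M = 4 * p * q * (p - a * q) * (p - b * q)"
    define m where "m = max \<bar>p\<bar> \<bar>q\<bar>"
    have FM: "F\<^sup>2 + \<bar>M\<bar> \<ge> 0" by simp
    have "m ^ 4 \<le> K * (F\<^sup>2 + \<bar>M\<bar>)"
    proof (cases "p\<^sup>2 \<ge> 4 * G * q\<^sup>2")
      case True
      have q2: "q\<^sup>2 \<le> G * q\<^sup>2" using G1 by (simp add: mult_le_cancel_right1)
      have "c * q\<^sup>2 \<le> G * q\<^sup>2" by (simp add: G_def mult_right_mono)
      moreover have True': "4 * (G * q\<^sup>2) \<le> p\<^sup>2" using True by (simp add: ac_simps)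
      moreover have "0 \<le> G * q\<^sup>2" using G1 by simp
      moreover have "w \<le> 2 * (w - u)" if "u \<le> v" "4 * v \<le> w" "0 \<le> v" for u v w :: int
        using that by presburger
      ultimately have pF: "p\<^sup>2 \<le> 2 * F" unfolding F_def by blast
      have "u \<le> w" if "u \<le> v" "4 * v \<le> w" "0 \<le> u" for u v w :: int
        using that by presburger
      then have "q\<^sup>2 \<le> p\<^sup>2" using True' q2 zero_le_power2[of q] by blast
      then have "m\<^sup>2 = p\<^sup>2" by (simp add: m_def abs_le_square_iff max_def)
      then have "m ^ 4 = p\<^sup>2 * p\<^sup>2" by (simp add: power4_eq_xxxx power2_eq_square)
      also have "\<dots> \<le> (2 * F) * (2 * F)" 
        using pF order_trans[OF zero_le_power2 pF] by (intro mult_mono) auto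
      also have "\<dots> = 4 * F\<^sup>2" by (simp add: power2_eq_square)
      also have "\<dots> \<le> K * (F\<^sup>2 + \<bar>M\<bar>)" using K16 unfolding K_def
        by (intro mult_mono) auto
      finally show ?thesis .
    next
      case False
      then have q0: "q \<noteq> 0" by auto
      have "p\<^sup>2 \<le> (2 * G * \<bar>q\<bar>)\<^sup>2"
      proof -
        have "4 * G * q\<^sup>2 \<le> 4 * (G * G) * q\<^sup>2" using G1 by (intro mult_right_mono) auto
        then show ?thesis using False by (simp add: power_mult_distrib power2_eq_square ac_simps)
      qed
      then have pq: "\<bar>p\<bar> \<le> 2 * G * \<bar>q\<bar>" using G1 by (simp flip: abs_le_square_iff add: abs_mult)
      have m: "m \<le> 2 * G * \<bar>q\<bar>" using pq G1 by (auto simp: m_def mult_le_cancel_right1)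
      \<comment> \<open>\<open>L\<close> and \<open>U\<close> are the cofactors of a Bezout identity
        eliminating \<open>p\<close> from \<open>F\<close> and \<open>M\<close>. The left side of
        \<open>ident\<close> is nonzero because \<open>a\<close>, \<open>b\<close>,
        \<open>a - b\<close> and \<open>q\<close> are.\<close>
      define L U where "L = 2 * p + (a + b) * q" and "U = 4 * c * q\<^sup>2 + (p - (a + b) * q) * L"
      have ident: "4 * q * (c * (a - b)\<^sup>2 * q ^ 4) = 4 * q * U * F - L * M"
        unfolding L_def U_def F_def M_def c_def by algebra
      have sq: "\<bar>(a + b) * q\<bar> = s * \<bar>q\<bar>" by (simp add: s_def abs_mult)
      have L: "\<bar>L\<bar> \<le> K2 * \<bar>q\<bar>"
        using pq sq unfolding L_def K2_def by (simp add: algebra_simps)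
      have "\<bar>p - (a + b) * q\<bar> \<le> (2 * G + s) * \<bar>q\<bar>"
        using pq sq by (simp add: algebra_simps)
      then have "\<bar>(p - (a + b) * q) * L\<bar> \<le> ((2 * G + s) * \<bar>q\<bar>) * (K2 * \<bar>q\<bar>)"
        unfolding abs_mult using L by (intro mult_mono) auto
      also have "\<dots> = (2 * G + s) * K2 * q\<^sup>2" by (simp add: power2_eq_square ac_simps flip: abs_mult)
      finally have "\<bar>(p - (a + b) * q) * L\<bar> \<le> (2 * G + s) * K2 * q\<^sup>2" .
      moreover have "\<bar>4 * c * q\<^sup>2\<bar> = 4 * G * q\<^sup>2" by (simp add: G_def abs_mult)
      ultimately have "\<bar>U\<bar> \<le> 4 * G * q\<^sup>2 + (2 * G + s) * K2 * q\<^sup>2"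
        unfolding U_def by (intro order_trans[OF abs_triangle_ineq] add_mono) simp_all
      then have U: "\<bar>U\<bar> \<le> K1 * q\<^sup>2" by (simp add: K1_def K2_def distrib_right)
      have UF: "\<bar>4 * q * U * F\<bar> \<le> \<bar>q\<bar> * (4 * (K1 * q\<^sup>2) * \<bar>F\<bar>)"
      proof -
        have "\<bar>4 * q * U * F\<bar> = \<bar>q\<bar> * (4 * \<bar>U\<bar> * \<bar>F\<bar>)" by (simp add: abs_mult)
        also have "\<dots> \<le> \<bar>q\<bar> * (4 * (K1 * q\<^sup>2) * \<bar>F\<bar>)"
          using U by (intro mult_left_mono mult_right_mono) auto
        finally show ?thesis .
      qed
      have LM: "\<bar>L * M\<bar> \<le> \<bar>q\<bar> * (K2 * \<bar>M\<bar>)"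
        using mult_right_mono[OF L abs_ge_zero[of M]] by (simp add: abs_mult ac_simps)
      have "0 < G * (a - b)\<^sup>2" using G1 assms by (intro mult_pos_pos) auto
      then have "1 \<le> G * (a - b)\<^sup>2" by simp
      then have "q ^ 4 \<le> G * (a - b)\<^sup>2 * q ^ 4" by (simp add: mult_le_cancel_right1)
      then have "\<bar>q\<bar> * (4 * q ^ 4) \<le> \<bar>q\<bar> * (4 * (G * (a - b)\<^sup>2 * q ^ 4))"
        by (intro mult_left_mono) auto
      also have "\<dots> = \<bar>4 * q * (c * (a - b)\<^sup>2 * q ^ 4)\<bar>" by (simp add: abs_mult G_def)
      also have "\<dots> \<le> \<bar>q\<bar> * (4 * (K1 * q\<^sup>2) * \<bar>F\<bar>) + \<bar>q\<bar> * (K2 * \<bar>M\<bar>)"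
        unfolding ident using UF LM by linarith
      finally have "\<bar>q\<bar> * (4 * q ^ 4) \<le> \<bar>q\<bar> * (4 * (K1 * q\<^sup>2) * \<bar>F\<bar> + K2 * \<bar>M\<bar>)"
        by (simp add: distrib_left)
      then have q4: "4 * q ^ 4 \<le> 4 * (K1 * q\<^sup>2) * \<bar>F\<bar> + K2 * \<bar>M\<bar>" using q0 by simp
      \<comment> \<open>The bound \<open>q4\<close> is linear in \<open>F\<close>. Completing the
        square replaces \<open>4 * K1 * q^2 * |F|\<close> by at most
        \<open>q^4 + 4 * K1^2 * F^2\<close>, and the left side of \<open>q4\<close> has multiples of
        \<open>q^4\<close> to spare.\<close>
      have "0 \<le> (q\<^sup>2 - 2 * K1 * \<bar>F\<bar>)\<^sup>2" by simp
      also have "\<dots> = q ^ 4 - 4 * (K1 * q\<^sup>2) * \<bar>F\<bar> + 4 * K1\<^sup>2 * F\<^sup>2"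
        by (simp add: power2_eq_square algebra_simps power4_eq_xxxx flip: abs_mult)
      finally have "0 \<le> q ^ 4 - 4 * (K1 * q\<^sup>2) * \<bar>F\<bar> + 4 * K1\<^sup>2 * F\<^sup>2" .
      moreover have "u \<le> y + z" if "4 * u \<le> x + z" "0 \<le> u - x + y" "0 \<le> u" for u x y z :: int
        using that by presburger
      ultimately have "q ^ 4 \<le> 4 * K1\<^sup>2 * F\<^sup>2 + K2 * \<bar>M\<bar>"
        using q4 zero_le_even_power'[of q 2] by (simp add: numeral_eq_Suc)
      also have "\<dots> \<le> (16 * K1\<^sup>2 + 2 * K2) * (F\<^sup>2 + \<bar>M\<bar>)"
        using K1 K2 by (simp add: algebra_simps)
      finally have q4': "q ^ 4 \<le> (16 * K1\<^sup>2 + 2 * K2) * (F\<^sup>2 + \<bar>M\<bar>)" .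
      have "m ^ 4 \<le> (2 * G * \<bar>q\<bar>) ^ 4" using m by (intro power_mono) (auto simp: m_def)
      also have "\<dots> = 16 * G ^ 4 * q ^ 4" by (simp add: power_mult_distrib)
      also have "\<dots> \<le> 16 * G ^ 4 * ((16 * K1\<^sup>2 + 2 * K2) * (F\<^sup>2 + \<bar>M\<bar>))"
        using q4' by (intro mult_left_mono) auto
      also have "\<dots> \<le> K * (F\<^sup>2 + \<bar>M\<bar>)"
        unfolding K_def mult.assoc[symmetric] using FM by (intro mult_right_mono) auto
      finally show ?thesis .
    qed
    then show "(max \<bar>p\<bar> \<bar>q\<bar>) ^ 4 \<le>
        K * ((p\<^sup>2 - a * b * q\<^sup>2)\<^sup>2 + \<bar>4 * p * q * (p - a * q) * (p - b * q)\<bar>)"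
      by (simp add: m_def F_def M_def c_def)
  qed
qed

text \<open>This bounds the cancellation in the duplication formula. A common divisor is split along
  the factors of the second form, and the first form is reduced modulo each piece, where it becomes
  a constant times a power of \<open>q\<close> or, for the piece dividing \<open>q\<close>, a power
  of \<open>p\<close>.\<close>

lemma double_forms_common_divisor:
  fixes a b p q g :: int
  assumes cop: "coprime p q"
    and N: "g dvd (p\<^sup>2 - a * b * q\<^sup>2)\<^sup>2" and M: "g dvd 4 * p * q * (p - a * q) * (p - b * q)"
  shows "g dvd 4 * (a * b)\<^sup>2 * (a * (a - b))\<^sup>2 * (b * (a - b))\<^sup>2"
proof -
  let ?N = "(p\<^sup>2 - a * b * q\<^sup>2)\<^sup>2"
  \<comment> \<open>Modulo \<open>d\<close>, \<open>p\<close> is \<open>l * q\<close>, so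
    \<open>?N\<close> becomes \<open>k^2 * q^4\<close> with \<open>q\<close> invertible. The roots
    \<open>l\<close> used below are 0, \<open>a\<close> and \<open>b\<close>.\<close>
  have red: "d dvd k\<^sup>2" if d: "d dvd g" "d dvd p - l * q" and k: "k = l\<^sup>2 - a * b" for d k l
  proof -
    have "p - l * q dvd ?N - (k * q\<^sup>2)\<^sup>2"
    proof -
      have "?N - (k * q\<^sup>2)\<^sup>2 = (p - l * q) * ((p + l * q) * (p\<^sup>2 - a * b * q\<^sup>2 + k * q\<^sup>2))"
        unfolding k by algebra
      then show ?thesis by simp
    qed
    then have "d dvd ?N - (k * q\<^sup>2)\<^sup>2" using d dvd_trans by blast
    moreover have "d dvd ?N" using d N dvd_trans by blast
    ultimately have *: "d dvd k\<^sup>2 * q ^ 4"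
      by (simp add: dvd_diff_right_iff power_mult_distrib flip: power_mult)
    have "coprime d q"
    proof (rule coprimeI)
      fix e assume e: "e dvd d" "e dvd q"
      then have "e dvd (p - l * q) + l * q" using d by (meson dvd_add dvd_mult dvd_trans)
      then show "is_unit e" using coprime_common_divisor[OF cop, of e] e by simp
    qed
    then have "coprime d (q ^ 4)" by simp
    then show ?thesis using * by (simp add: coprime_dvd_mult_left_iff)
  qed
  obtain g4 b5 where 1: "g = g4 * b5" "g4 dvd 4 * p * q * (p - a * q)" "b5 dvd p - b * q"
    using division_decomp[OF M] by blast
  obtain g3 b4 where 2: "g4 = g3 * b4" "g3 dvd 4 * p * q" "b4 dvd p - a * q"
    using division_decomp[OF 1(2)] by blast
  obtain g2 b3 where 3: "g3 = g2 * b3" "g2 dvd 4 * p" "b3 dvd q"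
    using division_decomp[OF 2(2)] by blast
  obtain b1 b2 where 4: "g2 = b1 * b2" "b1 dvd 4" "b2 dvd p"
    using division_decomp[OF 3(2)] by blast
  have g: "g = b1 * b2 * b3 * b4 * b5" using 1 2 3 4 by simp
  have "b2 dvd (a * b)\<^sup>2" using red[of b2 0 "- (a * b)"] 4 g by simp
  moreover have "b4 dvd (a * (a - b))\<^sup>2"
    using red[of b4 a "a * (a - b)"] 2 g by (simp add: algebra_simps power2_eq_square)
  moreover have "b5 dvd (b * (a - b))\<^sup>2"
    using red[of b5 b "- (b * (a - b))"] 1 g by (simp add: algebra_simps power2_eq_square)
  moreover have "is_unit b3"
  proof -
    have "b3 dvd ?N" using g N by (meson dvd_mult dvd_mult2 dvd_trans dvd_refl)
    moreover have "?N = p ^ 4 + q * (q * (a * b) * (a * b * q\<^sup>2 - 2 * p\<^sup>2))" by algebra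
    ultimately have "b3 dvd p ^ 4" using 3(3) by (simp add: dvd_add_left_iff)
    moreover have "coprime (p ^ 4) q" using cop by simp
    ultimately show ?thesis using 3(3) coprime_common_divisor by blast
  qed
  ultimately have "b1 * b2 * b3 * b4 * b5 dvd
      4 * (a * b)\<^sup>2 * 1 * (a * (a - b))\<^sup>2 * (b * (a - b))\<^sup>2"
    using 4(2) by (intro mult_dvd_mono) auto
  then show ?thesis using g by simp
qed

text \<open>The relation is the duplication formula with its denominator cleared. Doubling has
  degree 4 and its fraction loses only a bounded factor in reduction, so the fourth power of the
  height of the half is at most a constant times the height of the double.\<close>

lemma rat_height_double:
  fixes a b :: int
  assumes ab: "a \<noteq> 0" "b \<noteq> 0" "a \<noteq> b"
  shows "\<exists>K. \<forall>x x'. (x'\<^sup>2 - of_int a * of_int b)\<^sup>2 = 4 * x * x' * (x' - of_int a) * (x' - of_int b) \<longrightarrow>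
           rat_height x' \<le> max K (rat_height x)"
proof -
  obtain K where K: "K \<ge> 0" "\<And>p q. (max \<bar>p\<bar> \<bar>q\<bar>) ^ 4 \<le>
     K * ((p\<^sup>2 - a * b * q\<^sup>2)\<^sup>2 + \<bar>4 * p * q * (p - a * q) * (p - b * q)\<bar>)"
    using double_forms_lower_bound[OF ab] by blast
  define C where "C = 4 * (a * b)\<^sup>2 * (a * (a - b))\<^sup>2 * (b * (a - b))\<^sup>2"
  have C: "C > 0" using ab by (simp add: C_def)
  show ?thesis
  proof (intro exI[of _ "2 * K * C"] allI impI)
    fix x x' :: rat
    assume rel: "(x'\<^sup>2 - of_int a * of_int b)\<^sup>2 = 4 * x * x' * (x' - of_int a) * (x' - of_int b)"
    obtain p q where pq: "quotient_of x' = (p, q)" by (cases "quotient_of x'")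
    obtain c d where cd: "quotient_of x = (c, d)" by (cases "quotient_of x")
    have q: "q > 0" "coprime p q" "x' = of_int p / of_int q"
      using pq quotient_of_denom_pos quotient_of_coprime quotient_of_div by blast+
    have d: "d > 0" "coprime c d" "x = of_int c / of_int d"
      using cd quotient_of_denom_pos quotient_of_coprime quotient_of_div by blast+
    define N M where "N = (p\<^sup>2 - a * b * q\<^sup>2)\<^sup>2" and "M = 4 * p * q * (p - a * q) * (p - b * q)"
    \<comment> \<open>As \<open>c / d\<close> is in lowest terms, this yields
      \<open>N = c * g\<close> and \<open>M = d * g\<close>, where \<open>g\<close> is the cancelled
      factor.\<close>
    have "N * d = c * M"
    proof -
      have P: "of_int p = x' * of_int q" "of_int c = x * of_int d" using q d by simp_all
      have "of_int (N * d) = (((of_int p)\<^sup>2 - of_int a * of_int b * (of_int q)\<^sup>2)\<^sup>2 * of_int d :: rat)"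
        by (simp add: N_def)
      also have "\<dots> = of_int c * (4 * of_int p * of_int q * (of_int p - of_int a * of_int q) *
          (of_int p - of_int b * of_int q))"
        unfolding P using rel by algebra
      also have "\<dots> = of_int (c * M)" by (simp add: M_def)
      finally have "of_int (N * d) = (of_int (c * M) :: rat)" .
      then show ?thesis by (simp only: of_int_eq_iff)
    qed
    moreover from this have "d dvd c * M" by (metis dvd_triv_right)
    then have "d dvd M" using d by (simp add: coprime_dvd_mult_right_iff coprime_commute)
    then obtain g where g: "M = d * g" by blast
    ultimately have g': "N = c * g" using d by simp
    have "g dvd C"
      unfolding C_def using q g g' by (intro double_forms_common_divisor[of p q]) (auto simp: N_def M_def)
    then have gC: "\<bar>g\<bar> \<le> C" using C by (simp add: dvd_imp_le_int zdvd_imp_le)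
    define h h' where "h = rat_height x" and "h' = rat_height x'"
    have h: "h = max \<bar>c\<bar> \<bar>d\<bar>" "h' = max \<bar>p\<bar> \<bar>q\<bar>" using pq cd by (simp_all add: h_def h'_def rat_height_def)
    have h1: "h \<ge> 1" "h' \<ge> 1" by (simp_all add: h_def h'_def rat_height_pos)
    have "\<bar>c\<bar> \<le> h" "\<bar>d\<bar> \<le> h" by (simp_all add: h)
    then have "\<bar>N\<bar> \<le> h * C" "\<bar>M\<bar> \<le> h * C"
      unfolding g g' abs_mult using gC h1 by (auto intro!: mult_mono)
    then have "N + \<bar>M\<bar> \<le> 2 * (h * C)" by linarith
    then have "K * (N + \<bar>M\<bar>) \<le> K * (2 * (h * C))" using K(1) by (rule mult_left_mono)
    then have le: "h' ^ 4 \<le> (2 * K * C) * h"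
      using K(2)[of p q] unfolding h(2) N_def M_def by (simp add: ac_simps)
    \<comment> \<open>Otherwise \<open>2 * K * C * h < h'^2 <= h'^4\<close>, against
      \<open>le\<close>.\<close>
    have "h' \<le> max (2 * K * C) h"
    proof (rule ccontr)
      assume "\<not> h' \<le> max (2 * K * C) h"
      then have lt: "2 * K * C < h'" "h < h'" by auto
      have "(2 * K * C) * h \<le> h' * h" using lt h1 by (intro mult_right_mono) auto
      also have "\<dots> < h' * h'" using lt h1 by simp
      also have "\<dots> \<le> h' * h' * (h' * h')" using h1
        by (smt (verit) mult_le_cancel_left1 mult_pos_pos)
      finally show False using le by (simp add: power4_eq_xxxx ac_simps)
    qed
    then show "rat_height x' \<le> max (2 * K * C) (rat_height x)" by (simp add: h_def h'_def)
  qed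
qed

text \<open>In terms of the 2-adic valuation, that of \<open>x\<close> is exactly \<open>-m\<close>.
  The value \<open>m = 0\<close> describes units, so genuine poles carry the extra condition
  \<open>m > 0\<close>.\<close>

definition two_adic_pole :: "nat \<Rightarrow> rat \<Rightarrow> bool" where
  "two_adic_pole m x \<longleftrightarrow> (\<exists>p c::int. odd p \<and> odd c \<and> x = of_int p / (2 ^ m * of_int c))"

lemma two_adic_pole_unique:
  assumes "two_adic_pole m x" "two_adic_pole n x"
  shows "m = n"
  using assms
proof (induction m n rule: linorder_wlog)
  case (le m n)
  obtain p c p' c' :: int where o: "odd p" "odd c" "odd p'" "odd c'"
    and x: "x = of_int p / (2 ^ m * of_int c)" "x = of_int p' / (2 ^ n * of_int c')"
    using le unfolding two_adic_pole_def by blast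
  have nz: "(of_int c :: rat) \<noteq> 0" "(of_int c' :: rat) \<noteq> 0" using o by auto
  have n: "n = m + (n - m)" using le by simp
  have "(2::rat) ^ n = 2 ^ m * 2 ^ (n - m)" using n by (metis power_add)
  with x nz have "(of_int (p * 2 ^ (n - m) * c') :: rat) = of_int (p' * c)"
    by (simp add: field_simps)
  then have "p * 2 ^ (n - m) * c' = p' * c" by (simp only: of_int_eq_iff)
  then have "odd (p * 2 ^ (n - m) * c')" using o by simp
  then show ?case using le by (cases "n - m") auto
next
  case (sym m n)
  then show ?case by simp
qed

text \<open>Near a 2-adic pole the double is close to \<open>x / 4\<close>: as \<open>B\<close> is
  even, \<open>p\<close>, \<open>p - a * B\<close> and \<open>p - b * B\<close> stay odd, and the
  factor 4 supplies the two further powers of 2.\<close>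

lemma two_adic_pole_double:
  fixes a b :: int
  assumes "two_adic_pole m x" "m > 0"
  shows "two_adic_pole (m + 2) (legendre_double (of_int a) (of_int b) x)"
proof -
  obtain p c :: int where o: "odd p" "odd c" and x: "x = of_int p / (2 ^ m * of_int c)"
    using assms unfolding two_adic_pole_def by blast
  define B where "B = 2 ^ m * c"
  have B: "even B" "B \<noteq> 0" using assms o by (auto simp: B_def)
  have xB: "x = of_int p / of_int B" by (simp add: x B_def)
  define P Q where "P = (p\<^sup>2 - a * b * B\<^sup>2)\<^sup>2" and "Q = p * c * (p - a * B) * (p - b * B)"
  have odd: "odd P" "odd Q" using B o by (simp_all add: P_def Q_def)
  have Qnz: "p - a * B \<noteq> 0" "p - b * B \<noteq> 0" using B o by (metis dvd_mult eq_iff_diff_eq_0)+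
  have xa: "x - of_int a = of_int (p - a * B) / of_int B" "x - of_int b = of_int (p - b * B) / of_int B"
    using B by (simp_all add: xB field_simps)
  have num: "x\<^sup>2 - of_int a * of_int b = of_int (p\<^sup>2 - a * b * B\<^sup>2) / (of_int B)\<^sup>2"
    using B by (simp add: xB field_simps)
  have "legendre_double (of_int a) (of_int b) x = of_int P / (4 * of_int (p * B * (p - a * B) * (p - b * B)))"
    unfolding legendre_double_def xa num unfolding xB P_def of_int_mult[of "p * B * _"] of_int_mult[of "p * B"]
      of_int_mult[of p] of_int_power
    using B Qnz by (simp add: power_divide divide_simps power2_eq_square del: of_int_diff of_int_mult)
  also have "4 * (of_int (p * B * (p - a * B) * (p - b * B)) :: rat) = 2 ^ (m + 2) * of_int Q"
    by (simp add: Q_def B_def power_add)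
  finally show ?thesis unfolding two_adic_pole_def using odd by blast
qed

text \<open>Each \<open>f (Suc n)\<close> is a half of \<open>f n\<close>. Bounded heights make the
  sequence repeat a value, so \<open>f 0\<close> is periodic under doubling, although every doubling
  raises its pole order by 2.\<close>

lemma no_infinite_halving:
  fixes a b :: int and f :: "nat \<Rightarrow> rat"
  assumes ab: "a \<noteq> 0" "b \<noteq> 0" "a \<noteq> b"
    and rel: "\<And>n. ((f (Suc n))\<^sup>2 - of_int a * of_int b)\<^sup>2 =
                4 * f n * f (Suc n) * (f (Suc n) - of_int a) * (f (Suc n) - of_int b)"
    and pole: "two_adic_pole m (f 0)" "m > 0"
  shows False
proof -
  define D where "D = legendre_double (of_int a) (of_int b :: rat)"
  have D: "f n = D (f (Suc n))" for n
  proof -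
    let ?x = "f (Suc n)"
    \<comment> \<open>A vanishing denominator would put \<open>?x\<close> among 0, \<open>a\<close>,
      \<open>b\<close> and force \<open>?x^2 = a * b\<close>, which is impossible for distinct
      nonzero \<open>a\<close> and \<open>b\<close>.\<close>
    have "?x * (?x - of_int a) * (?x - of_int b) \<noteq> 0"
    proof
      assume 0: "?x * (?x - of_int a) * (?x - of_int b) = 0"
      then have "4 * f n * ?x * (?x - of_int a) * (?x - of_int b) = 0" by auto
      with rel[of n] have "(?x\<^sup>2 - of_int a * of_int b)\<^sup>2 = 0" by (rule trans)
      then have "?x\<^sup>2 = of_int a * of_int b" by simp
      then show False using 0 ab by (auto simp: power2_eq_square)
    qed
    then show ?thesis using rel[of n] unfolding D_def legendre_double_def by (simp add: field_simps)
  qed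
  obtain K where K: "\<And>n. rat_height (f (Suc n)) \<le> max K (rat_height (f n))"
    using rat_height_double[OF ab] rel by blast
  have "rat_height (f n) \<le> max K (rat_height (f 0))" for n
  proof (induction n)
    case (Suc n)
    then show ?case using K[of n] by linarith
  qed simp
  then have "range f \<subseteq> {x. rat_height x \<le> max K (rat_height (f 0))}" by blast
  then have "finite (range f)" by (rule finite_subset) (rule finite_rat_height_le)
  then have "\<not> inj f" using finite_imageD infinite_UNIV_nat by blast
  then obtain i j where ij: "i < j" "f i = f j" unfolding inj_def by (metis linorder_neqE_nat)
  have iter: "f i = (D ^^ n) (f (i + n))" for i n
  proof (induction n arbitrary: i)
    case (Suc n)
    then show ?case using D[of i] by (metis add_Suc_shift funpow.simps(2) o_apply)
  qed simp
  \<comment> \<open>Applying \<open>D\<close> \<open>k\<close> times fixes the repeated value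
    \<open>f i = f j\<close>; applying it \<open>i\<close> times maps that value to
    \<open>f 0\<close>, which is therefore fixed as well.\<close>
  define k where "k = j - i"
  have "f 0 = (D ^^ i) (f j)" using iter[of 0 i] ij by simp
  then have "(D ^^ k) (f 0) = (D ^^ i) ((D ^^ k) (f j))"
    by (metis add.commute funpow_add o_apply)
  also have "(D ^^ k) (f j) = f i" using iter[of i k] ij by (simp add: k_def)
  also have "(D ^^ i) (f i) = f 0" using iter[of 0 i] by simp
  finally have "(D ^^ k) (f 0) = f 0" .
  moreover have "two_adic_pole (m + 2 * n) ((D ^^ n) (f 0))" for n
  proof (induction n)
    case (Suc n)
    then show ?case using two_adic_pole_double[of "m + 2 * n" _ a b] pole(2) by (simp add: D_def)
  qed (use pole in simp)
  ultimately have "m + 2 * k = m" using two_adic_pole_unique pole(1) by metis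
  then show False using ij by (simp add: k_def)
qed

section \<open>Halving, differences and specialization\<close>

text \<open>\<open>r + s\<close> and \<open>r - s\<close> add up to \<open>2 * r\<close>, so they
  cannot both be regular.\<close>

lemma rf_pole_sum_or_diff:
  assumes "rf_has_pole r t"
  shows "\<exists>s'. s'\<^sup>2 = s\<^sup>2 \<and> rf_has_pole (r + s') t"
proof (rule ccontr)
  assume "\<not> ?thesis"
  then have "\<not> rf_has_pole (r + s) t" "\<not> rf_has_pole (r + - s) t"
    by (metis, metis power2_minus)
  then have "\<not> rf_has_pole ((r + s) + (r + - s)) t" by (rule rf_regular_add)
  moreover have "\<not> rf_has_pole (inverse 2) t"
    by (rule rf_regular_inverse) (simp_all add: rf_regular_numeral)
  ultimately have "\<not> rf_has_pole (((r + s) + (r + - s)) * inverse 2) t"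
    by (rule rf_regular_mult)
  then show False using assms by simp
qed

text \<open>If \<open>x - e\<^sub>i = r\<^sub>i\<^sup>2\<close>, the halves of \<open>(x, y)\<close> have
  \<open>x' - e\<^sub>1 = (r\<^sub>1 + r\<^sub>2) (r\<^sub>1 + r\<^sub>3)\<close>, one for each choice of signs; a suitable choice
  keeps the pole.\<close>
lemma exists_half_with_pole:
  fixes e1 e2 e3 :: "int poly"
  defines "E1 \<equiv> ipoly_to_rf e1" and "E2 \<equiv> ipoly_to_rf e2" and "E3 \<equiv> ipoly_to_rf e3"
  assumes curve: "y\<^sup>2 = (x - E1) * (x - E2) * (x - E3)"
    and pole: "rf_has_pole x t"
    and good_fibre: "ipoly_eval e1 t \<noteq> ipoly_eval e2 t"
                    "ipoly_eval e2 t \<noteq> ipoly_eval e3 t"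
                    "ipoly_eval e1 t \<noteq> ipoly_eval e3 t"
    and cond: "\<And>h. squarefree h \<Longrightarrow> degree h > 0 \<Longrightarrow>
                 h dvd (e1 - e2) * (e1 - e3) \<or> h dvd (e2 - e1) * (e2 - e3) \<or>
                 h dvd (e3 - e1) * (e3 - e2) \<Longrightarrow>
                 \<not> (\<exists>q::rat. q^2 = ipoly_eval h t)"
  shows "\<exists>x' y'. y'\<^sup>2 = (x' - E1) * (x' - E2) * (x' - E3) \<and> rf_has_pole x' t \<and>
           ((x' - E1)\<^sup>2 - (E2 - E1) * (E3 - E1))\<^sup>2 =
             4 * (x - E1) * (x' - E1) * (x' - E2) * (x' - E3)"
proof -
  \<comment> \<open>Translating one root to 0 gives the shape of \<open>square_if_pole\<close>. The
    reversed \<open>minus_mult_minus\<close> identifies \<open>(e2 - e1) * (e3 - e1)\<close> with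
    the product \<open>(e1 - e2) * (e1 - e3)\<close> of the hypothesis.\<close>
  have "\<exists>r. x - E1 = r\<^sup>2"
    using curve pole good_fibre cond
    by (intro square_if_pole[of y _ "e2 - e1" "e3 - e1" t])
      (auto simp: ipoly_to_rf_simps ipoly_eval_simps E1_def E2_def E3_def rf_pole_diff_ipoly
        minus_mult_minus[of "e2 - e1" "e3 - e1", symmetric] simp del: minus_mult_minus)
  moreover have "\<exists>r. x - E2 = r\<^sup>2"
    using curve pole good_fibre cond
    by (intro square_if_pole[of y _ "e1 - e2" "e3 - e2" t])
      (auto simp: ipoly_to_rf_simps ipoly_eval_simps E1_def E2_def E3_def rf_pole_diff_ipoly
        minus_mult_minus[of "e1 - e2" "e3 - e2", symmetric] simp del: minus_mult_minus)
  moreover have "\<exists>r. x - E3 = r\<^sup>2"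
    using curve pole good_fibre cond
    by (intro square_if_pole[of y _ "e1 - e3" "e2 - e3" t])
      (auto simp: ipoly_to_rf_simps ipoly_eval_simps E1_def E2_def E3_def rf_pole_diff_ipoly
        minus_mult_minus[of "e1 - e3" "e2 - e3", symmetric] simp del: minus_mult_minus)
  ultimately obtain r1 r2' r3' where r': "x - E1 = r1\<^sup>2" "x - E2 = r2'\<^sup>2" "x - E3 = r3'\<^sup>2"
    by blast
  have "rf_has_pole (r1\<^sup>2) t" using pole by (simp add: r'(1)[symmetric] E1_def rf_pole_diff_ipoly)
  then have p1: "rf_has_pole r1 t" using rf_regular_power2(1) by blast
  obtain r2 where r2: "r2\<^sup>2 = r2'\<^sup>2" "rf_has_pole (r1 + r2) t" using rf_pole_sum_or_diff[OF p1] by blast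
  obtain r3 where r3: "r3\<^sup>2 = r3'\<^sup>2" "rf_has_pole (r1 + r3) t" using rf_pole_sum_or_diff[OF p1] by blast
  \<comment> \<open>With the roots expressed by \<open>x\<close> and \<open>r1\<close>,
    \<open>r2\<close>, \<open>r3\<close>, facts such as
    \<open>x' - E2 = (r2 + r1) * (r2 + r3)\<close> become polynomial identities.\<close>
  have r: "E1 = x - r1\<^sup>2" "E2 = x - r2\<^sup>2" "E3 = x - r3\<^sup>2" using r' r2 r3 by (simp_all add: algebra_simps)
  define x' where "x' = E1 + (r1 + r2) * (r1 + r3)"
  define y' where "y' = (r1 + r2) * (r1 + r3) * (r2 + r3)"
  have "rf_has_pole (x' - E1) t" using r2 r3 by (simp add: x'_def rf_pole_mult)
  then have "rf_has_pole x' t" by (simp add: E1_def rf_pole_diff_ipoly)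
  moreover have "y'\<^sup>2 = (x' - E1) * (x' - E2) * (x' - E3)"
    unfolding x'_def y'_def r by algebra
  moreover have "((x' - E1)\<^sup>2 - (E2 - E1) * (E3 - E1))\<^sup>2 =
      4 * (x - E1) * (x' - E1) * (x' - E2) * (x' - E3)"
    unfolding x'_def r by algebra
  ultimately show ?thesis by blast
qed

text \<open>The line of slope \<open>l\<close> through \<open>(x1, y1)\<close> and
  \<open>(x2, -y2)\<close> meets the curve in a third point, whose \<open>x\<close> comes from the
  sum of the roots of a monic cubic.\<close>

lemma legendre_chord:
  fixes a b c :: "'a :: field"
  assumes "y1\<^sup>2 = (x1 - a) * (x1 - b) * (x1 - c)" "y2\<^sup>2 = (x2 - a) * (x2 - b) * (x2 - c)"
    and "x1 \<noteq> x2" "l * (x1 - x2) = y1 + y2" "x = l\<^sup>2 + a + b + c - x1 - x2"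
  shows "(l * (x - x1) + y1)\<^sup>2 = (x - a) * (x - b) * (x - c)"
proof -
  define f where "f = (\<lambda>z. (z - a) * (z - b) * (z - c))"
  have 1: "f x1 - y1\<^sup>2 = 0" using assms by (simp add: f_def)
  have "y1 - l * (x1 - x2) = - y2" using assms(4) by simp
  then have 2: "f x2 - (y1 - l * (x1 - x2))\<^sup>2 = 0" using assms by (simp add: f_def)
  \<comment> \<open>By the choice of \<open>x\<close>, cubic minus squared line minus
    \<open>(z - x1) * (z - x2) * (z - x)\<close> is at most linear in \<open>z\<close>; this is its
    linear interpolation at \<open>x1\<close>, \<open>x2\<close> and \<open>x\<close>.\<close>
  have "(x1 - x2) * (f x - (l * (x - x1) + y1)\<^sup>2) =
      (f x1 - y1\<^sup>2) * (x - x2) - (f x2 - (y1 - l * (x1 - x2))\<^sup>2) * (x - x1)"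
    unfolding f_def assms(5) by algebra
  then have "f x - (l * (x - x1) + y1)\<^sup>2 = 0" unfolding 1 2 using assms(3) by simp
  then show ?thesis by (simp add: f_def)
qed

text \<open>The point constructed here is \<open>(x1, y1) - (x2, y2)\<close> in the group of the curve.\<close>
lemma exists_difference_with_pole:
  fixes E1 E2 E3 :: rf
  assumes E: "\<not> rf_has_pole E1 t" "\<not> rf_has_pole E2 t" "\<not> rf_has_pole E3 t"
    and good: "rf_eval E1 t \<noteq> rf_eval E2 t" "rf_eval E2 t \<noteq> rf_eval E3 t" "rf_eval E1 t \<noteq> rf_eval E3 t"
    and c1: "y1\<^sup>2 = (x1 - E1) * (x1 - E2) * (x1 - E3)"
    and c2: "y2\<^sup>2 = (x2 - E1) * (x2 - E2) * (x2 - E3)"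
    and reg: "\<not> rf_has_pole x1 t" "\<not> rf_has_pole x2 t"
    and eq: "rf_eval x1 t = rf_eval x2 t" "rf_eval y1 t = rf_eval y2 t"
    and neq: "x1 \<noteq> x2 \<or> y1 \<noteq> y2"
  shows "\<exists>x y. y\<^sup>2 = (x - E1) * (x - E2) * (x - E3) \<and> rf_has_pole x t"
proof -
  have "\<not> rf_has_pole (y1\<^sup>2) t" "\<not> rf_has_pole (y2\<^sup>2) t"
    unfolding c1 c2 using E reg by (simp_all add: rf_regular_simps)
  then have regy: "\<not> rf_has_pole y1 t" "\<not> rf_has_pole y2 t" by (auto dest: rf_regular_sqrt)
  define v v1 v2 v3 where "v = rf_eval x1 t" and "v1 = rf_eval E1 t" and "v2 = rf_eval E2 t" and "v3 = rf_eval E3 t"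
  note v_defs = v_def v1_def v2_def v3_def
  have "rf_eval (y1\<^sup>2) t = (v - v1) * (v - v2) * (v - v3)"
    unfolding c1 v_defs using E reg by (simp add: rf_regular_simps)
  then have vy: "(rf_eval y1 t)\<^sup>2 = (v - v1) * (v - v2) * (v - v3)"
    using regy by (simp add: rf_regular_power2)
  note simps = rf_regular_simps E reg regy
  show ?thesis
  proof (cases "x1 = x2")
    case True
    then have "y1\<^sup>2 = y2\<^sup>2" using c1 c2 by simp
    \<comment> \<open>The difference is now the double of \<open>(x1, y1)\<close>, and equal values
      force \<open>y1\<close> to vanish at \<open>t\<close>: the specialized point is
      2-torsion.\<close>
    then have y2: "y2 = - y1" using neq True by (auto simp: power2_eq_iff)
    then have y1: "y1 \<noteq> 0" using neq True by auto
    have y0: "rf_eval y1 t = 0" using eq(2) regy(1) unfolding y2 by (simp add: rf_regular_uminus)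
    define X a b where "X = x1 - E1" and "a = E2 - E1" and "b = E3 - E1"
    define u where "u = X\<^sup>2 - a * b"
    \<comment> \<open>Duplication formula centred at \<open>E1\<close>. By \<open>sq\<close>,
      \<open>x - E2\<close> and \<open>x - E3\<close> are squares too, and \<open>y\<close> is the
      product of the three square roots.\<close>
    define x y where "x = E1 + (u / (2 * y1))\<^sup>2"
      and "y = u * (X\<^sup>2 - 2 * a * X + a * b) * (X\<^sup>2 - 2 * b * X + a * b) / (2 * y1) ^ 3"
    have cX: "y1\<^sup>2 = X * (X - a) * (X - b)" unfolding c1 X_def a_def b_def by simp
    have sq: "(u / (2 * y1))\<^sup>2 - a = ((X\<^sup>2 - 2 * a * X + a * b) / (2 * y1))\<^sup>2"
      "(u / (2 * y1))\<^sup>2 - b = ((X\<^sup>2 - 2 * b * X + a * b) / (2 * y1))\<^sup>2"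
    proof -
      have "u\<^sup>2 - a * (2 * y1)\<^sup>2 = (X\<^sup>2 - 2 * a * X + a * b)\<^sup>2"
        "u\<^sup>2 - b * (2 * y1)\<^sup>2 = (X\<^sup>2 - 2 * b * X + a * b)\<^sup>2"
        unfolding u_def power_mult_distrib cX by algebra+
      moreover have "(2 * y1)\<^sup>2 \<noteq> 0" using y1 by simp
      ultimately show "(u / (2 * y1))\<^sup>2 - a = ((X\<^sup>2 - 2 * a * X + a * b) / (2 * y1))\<^sup>2"
        "(u / (2 * y1))\<^sup>2 - b = ((X\<^sup>2 - 2 * b * X + a * b) / (2 * y1))\<^sup>2"
        unfolding power_divide by (metis diff_divide_distrib nonzero_mult_div_cancel_right)+
    qed
    have "y\<^sup>2 = (u / (2 * y1))\<^sup>2 * ((u / (2 * y1))\<^sup>2 - a) * ((u / (2 * y1))\<^sup>2 - b)"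
      unfolding sq unfolding y_def by (simp add: power_divide power_mult_distrib flip: power_mult) 
    then have "y\<^sup>2 = (x - E1) * (x - E2) * (x - E3)"
      unfolding x_def a_def b_def by (simp add: algebra_simps)
    moreover have "rf_has_pole (x - E1) t"
    proof (rule rf_pole_if_inverse_eval_0)
      show "(x - E1) * (2 * y1)\<^sup>2 = u\<^sup>2" using y1 by (simp add: x_def power_divide)
      show "\<not> rf_has_pole ((2 * y1)\<^sup>2) t" "rf_eval ((2 * y1)\<^sup>2) t = 0"
        using y0 by (simp_all add: simps)
      show "\<not> rf_has_pole (u\<^sup>2) t" by (simp add: u_def X_def a_def b_def simps)
      have "rf_eval u t = (v - v1)\<^sup>2 - (v2 - v1) * (v3 - v1)"
        by (simp add: u_def X_def a_def b_def v_defs simps)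
      \<comment> \<open>\<open>v\<close> is one of the three roots, where this expression is, up to
        sign, a product of two root differences.\<close>
      moreover have "(v - v1)\<^sup>2 - (v2 - v1) * (v3 - v1) \<noteq> 0"
        using vy y0 good by (auto simp: v_defs power2_eq_square simp flip: left_diff_distrib right_diff_distrib)
      ultimately show "rf_eval (u\<^sup>2) t \<noteq> 0" by (simp add: u_def X_def a_def b_def simps)
    qed
    then have "rf_has_pole x t" using rf_regular_diff(1) E(1) by blast
    ultimately show ?thesis by blast
  next
    case False
    define l where "l = (y1 + y2) / (x1 - x2)"
    have l: "l * (x1 - x2) = y1 + y2" using False by (simp add: l_def)
    define x where "x = l\<^sup>2 + E1 + E2 + E3 - x1 - x2"
    have "rf_has_pole l t"
    proof (cases "rf_eval y1 t = 0")
      case False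
      then show ?thesis
        by (intro rf_pole_if_inverse_eval_0[OF _ _ _ _ l]) (use eq in \<open>simp_all add: simps\<close>)
    next
      case True
      \<comment> \<open>Numerator and denominator of \<open>l\<close> both vanish at
        \<open>t\<close> here. Multiplying by \<open>y1 - y2\<close> turns \<open>l\<close> into a
        quotient of \<open>G\<close>, the difference quotient of the cubic, whose value at
        \<open>t\<close> is the derivative at a simple root.\<close>
      define G where "G = (x1 - E1)\<^sup>2 + (x1 - E1) * (x2 - E1) + (x2 - E1)\<^sup>2
        - (E2 - E1 + (E3 - E1)) * (x1 - E1 + (x2 - E1)) + (E2 - E1) * (E3 - E1)"
      have "(x1 - x2) * G = y1\<^sup>2 - y2\<^sup>2" unfolding c1 c2 G_def by algebra
      also have "\<dots> = (x1 - x2) * (l * (y1 - y2))" using l by algebra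
      finally have G: "l * (y1 - y2) = G" using \<open>x1 \<noteq> x2\<close> by simp
      have "rf_eval G t = 3 * (v - v1)\<^sup>2 - 2 * (v2 - v1 + (v3 - v1)) * (v - v1) + (v2 - v1) * (v3 - v1)"
        using eq by (simp add: G_def v_defs simps algebra_simps power2_eq_square)
      moreover have "\<dots> \<noteq> 0"
      proof -
        consider "v = v1" | "v = v2" | "v = v3" using vy True by auto
        then show ?thesis
        proof cases
          case 1
          then show ?thesis using good by (simp add: v_defs)
        next
          case 2
          have "3 * (v - v1)\<^sup>2 - 2 * (v2 - v1 + (v3 - v1)) * (v - v1) + (v2 - v1) * (v3 - v1) = (v2 - v1) * (v2 - v3)"
            unfolding 2 by algebra
          then show ?thesis using good by (simp add: v_defs)
        next
          case 3
          have "3 * (v - v1)\<^sup>2 - 2 * (v2 - v1 + (v3 - v1)) * (v - v1) + (v2 - v1) * (v3 - v1) = (v3 - v1) * (v3 - v2)"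
            unfolding 3 by algebra
          then show ?thesis using good by (simp add: v_defs)
        qed
      qed
      ultimately have "rf_eval G t \<noteq> 0" by simp
      moreover have "\<not> rf_has_pole G t" by (simp add: G_def simps)
      ultimately show ?thesis
        by (intro rf_pole_if_inverse_eval_0[OF _ _ _ _ G]) (use eq in \<open>simp_all add: simps\<close>)
    qed
    then have "rf_has_pole (l\<^sup>2) t" using rf_regular_sqrt by blast
    moreover have "l\<^sup>2 = x + (x1 + x2 - E1 - E2 - E3)" by (simp add: x_def)
    moreover have "\<not> rf_has_pole (x1 + x2 - E1 - E2 - E3) t" by (simp add: simps)
    ultimately have "rf_has_pole x t" using rf_regular_add(1) by metis
    moreover have "(l * (x - x1) + y1)\<^sup>2 = (x - E1) * (x - E2) * (x - E3)"
      using legendre_chord[OF c1 c2 False l x_def] .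
    ultimately show ?thesis by blast
  qed
qed

section \<open>Specialization at points 2-adically close to \<open>t\<close>\<close>

lemma shifted_poly_clear_denominators:
  fixes p :: "rat poly" and t :: rat
  obtains n :: int and P :: "int poly" where
    "n > 0" "\<And>s::int. of_int n * poly p (t + of_int s) = of_int (poly P s)"
proof -
  obtain n P where n: "n > 0" "smult (of_int n) (pcompose p [:t, 1:]) = map_poly of_int (P :: int poly)"
    using rat_poly_clear_denominators by blast
  have ev: "poly (map_poly of_int P) (of_int s) = (of_int (poly P s) :: rat)" for s :: int
    by (induction P) (simp_all add: map_poly_pCons)
  have "of_int n * poly p (t + of_int s) = of_int (poly P s)" for s :: int
    using arg_cong[OF n(2), of "\<lambda>q. poly q (of_int s)"] 
    by (simp add: poly_pcompose ev)
  then show ?thesis using n(1) that by blast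
qed

text \<open>\<open>2^k\<close> divides the denominator, while the numerator is congruent to
  \<open>poly u 0\<close> modulo \<open>2^k\<close> and so keeps its 2-adic valuation
  \<open>e < k\<close>.\<close>

lemma two_adic_pole_quotient:
  fixes u w :: "int poly"
  assumes u: "poly u 0 \<noteq> 0" and w: "poly w 0 = 0"
    and k: "\<bar>poly u 0\<bar> < 2 ^ k" and nz: "poly w (2 ^ k) \<noteq> 0"
  shows "\<exists>m>0. two_adic_pole m (of_int (poly u (2 ^ k)) / of_int (poly w (2 ^ k)))"
proof -
  obtain u' where U: "u = pCons (poly u 0) u'" by (cases u) auto
  obtain w' where W: "w = pCons 0 w'" using w by (cases w) auto
  obtain c where c: "poly u 0 = 2 ^ multiplicity 2 (poly u 0) * c" "odd c"
    using multiplicity_decompose'[of "poly u 0" 2] u by auto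
  define e where "e = multiplicity 2 (poly u 0)"
  have "(2::int) ^ e \<le> \<bar>poly u 0\<bar>" using c u unfolding e_def
    by (metis dvd_triv_left dvd_imp_le_int abs_numeral power_abs)
  then have "(2::int) ^ e < 2 ^ k" using k by linarith
  then have ek: "e < k" by (simp add: power_strict_increasing_iff)
  then have pow: "(2::int) ^ k = 2 ^ e * 2 ^ (k - e)" by (simp flip: power_add)
  define c' where "c' = c + 2 ^ (k - e) * poly u' (2 ^ k)"
  have "poly u (2 ^ k) = poly u 0 + 2 ^ k * poly u' (2 ^ k)"
    using arg_cong[OF U, of "\<lambda>p. poly p (2 ^ k)"] by simp
  also have "poly u 0 = 2 ^ e * c" using c(1) by (simp add: e_def)
  finally have uk: "poly u (2 ^ k) = 2 ^ e * c'" unfolding c'_def pow by (simp add: algebra_simps)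
  have c': "odd c'" using c ek by (simp add: c'_def)
  have wk: "poly w (2 ^ k) = 2 ^ k * poly w' (2 ^ k)" by (simp add: W)
  then have "poly w' (2 ^ k) \<noteq> 0" using nz by auto
  then obtain d where d: "poly w' (2 ^ k) = 2 ^ multiplicity 2 (poly w' (2 ^ k)) * d" "odd d"
    using multiplicity_decompose'[of "poly w' (2 ^ k)" 2] by auto
  define j where "j = multiplicity 2 (poly w' (2 ^ k))"
  have "poly w (2 ^ k) = 2 ^ e * (2 ^ (k - e + j) * d)"
    unfolding wk using d(1) pow by (simp add: j_def power_add)
  then have "(of_int (poly u (2 ^ k)) / of_int (poly w (2 ^ k)) :: rat) = of_int c' / (2 ^ (k - e + j) * of_int d)"
    using uk by simp
  then have "two_adic_pole (k - e + j) (of_int (poly u (2 ^ k)) / of_int (poly w (2 ^ k)))"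
    unfolding two_adic_pole_def using c' d(2) by blast
  then show ?thesis using ek by (intro exI[of _ "k - e + j"]) simp
qed

lemma rf_pole_quotient:
  assumes "rf_has_pole f t"
  obtains A B where "f = Fract A B" "B \<noteq> 0" "poly A t \<noteq> 0" "poly B t = 0"
proof -
  note i = rf_pole_inverse[OF assms]
  obtain p q where pq: "poly q t \<noteq> 0" "inverse f = Fract p q" "rf_eval (inverse f) t = poly p t / poly q t"
    using i(2) by (rule rf_regularE)
  have "poly p t = 0" using pq i(3) by simp
  moreover have "f = Fract q p" using arg_cong[OF pq(2), of inverse] by simp
  moreover have "p \<noteq> 0"
  proof
    assume "p = 0"
    moreover have "q \<noteq> 0" using pq(1) by auto
    ultimately have "inverse f = 0" using pq(2) by (simp add: Zero_fract_def eq_fract)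
    then show False using i(1) by simp
  qed
  ultimately show ?thesis using that pq(1) by blast
qed

text \<open>The double of a point with a pole has a pole: dividing the relation by
  \<open>X'^4\<close> and evaluating would give 1 = 0.\<close>

lemma rf_regular_half:
  fixes a b :: rf
  assumes ab: "\<not> rf_has_pole a t" "\<not> rf_has_pole b t" and X: "\<not> rf_has_pole X t"
    and rel: "(X'\<^sup>2 - a * b)\<^sup>2 = 4 * X * X' * (X' - a) * (X' - b)"
  shows "\<not> rf_has_pole X' t"
proof
  assume pole: "rf_has_pole X' t"
  note i = rf_pole_inverse[OF pole]
  define w where "w = inverse X'"
  have w: "X' * w = 1" "\<not> rf_has_pole w t" "rf_eval w t = 0" using i by (simp_all add: w_def)
  have "(1 - a * b * w\<^sup>2)\<^sup>2 = ((X'\<^sup>2 - a * b) * w\<^sup>2)\<^sup>2" using w(1) by algebra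
  also have "\<dots> = (X'\<^sup>2 - a * b)\<^sup>2 * w ^ 4" by (simp add: power_mult_distrib flip: power_mult)
  also have "\<dots> = 4 * X * w * (1 - a * w) * (1 - b * w)" unfolding rel using w(1) by algebra
  finally have "rf_eval ((1 - a * b * w\<^sup>2)\<^sup>2) t = rf_eval (4 * X * w * (1 - a * w) * (1 - b * w)) t"
    by simp
  then show False using w ab X by (simp add: rf_regular_simps)
qed

text \<open>Halving forever in Q(t) and evaluating at \<open>t1 = t + 2^k\<close> gives a halving
  sequence of rationals that starts at a 2-adic pole, which \<open>no_infinite_halving\<close>
  forbids.\<close>

lemma no_point_with_pole:
  fixes e1 e2 e3 :: "int poly"
  defines "E1 \<equiv> ipoly_to_rf e1" and "E2 \<equiv> ipoly_to_rf e2" and "E3 \<equiv> ipoly_to_rf e3"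
  assumes good_fibre: "ipoly_eval e1 t \<noteq> ipoly_eval e2 t"
                    "ipoly_eval e2 t \<noteq> ipoly_eval e3 t"
                    "ipoly_eval e1 t \<noteq> ipoly_eval e3 t"
    and cond: "\<And>h. squarefree h \<Longrightarrow> degree h > 0 \<Longrightarrow>
                 h dvd (e1 - e2) * (e1 - e3) \<or> h dvd (e2 - e1) * (e2 - e3) \<or>
                 h dvd (e3 - e1) * (e3 - e2) \<Longrightarrow>
                 \<not> (\<exists>q::rat. q^2 = ipoly_eval h t)"
    and curve: "y\<^sup>2 = (x - E1) * (x - E2) * (x - E3)"
  shows "\<not> rf_has_pole x t"
proof
  assume pole: "rf_has_pole x t"
  define S where "S = {x. rf_has_pole x t \<and> (\<exists>y. y\<^sup>2 = (x - E1) * (x - E2) * (x - E3))}"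
  define R where "R = (\<lambda>x x'. ((x' - E1)\<^sup>2 - (E2 - E1) * (E3 - E1))\<^sup>2 =
             4 * (x - E1) * (x' - E1) * (x' - E2) * (x' - E3))"
  have step: "\<exists>x'. x' \<in> S \<and> R x x'" if "x \<in> S" for x
    using that exists_half_with_pole[OF _ _ good_fibre cond, of _ x]
    unfolding S_def R_def E1_def E2_def E3_def by blast
  have "\<exists>f. \<forall>n. (f n \<in> S \<and> (n = 0 \<longrightarrow> f n = x)) \<and> R (f n) (f (Suc n))"
  proof (rule dependent_nat_choice)
    show "\<exists>z. z \<in> S \<and> (0 = (0::nat) \<longrightarrow> z = x)" using pole curve by (auto simp: S_def)
  qed (use step in auto)
  then obtain f where f: "f 0 = x" "\<And>n. R (f n) (f (Suc n))" by blast
  define a b where "a = e2 - e1" and "b = e3 - e1"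
  define X where "X = (\<lambda>n. f n - E1)"
  have rel: "((X (Suc n))\<^sup>2 - ipoly_to_rf a * ipoly_to_rf b)\<^sup>2 =
      4 * X n * X (Suc n) * (X (Suc n) - ipoly_to_rf a) * (X (Suc n) - ipoly_to_rf b)" for n
    using f(2)[of n] by (simp add: R_def X_def a_def b_def ipoly_to_rf_simps E1_def E2_def E3_def)
  have "rf_has_pole (X 0) t" using pole f(1) by (simp add: X_def E1_def rf_pole_diff_ipoly)
  then obtain A B where X0: "X 0 = Fract A B" "B \<noteq> 0" "poly A t \<noteq> 0" "poly B t = 0"
    by (rule rf_pole_quotient)
  let ?a = "map_poly of_int a :: rat poly" and ?b = "map_poly of_int b :: rat poly"
  obtain nA PA where A: "nA > 0" "\<And>s::int. of_int nA * poly A (t + of_int s) = of_int (poly PA s)"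
    by (rule shifted_poly_clear_denominators[of A t]) auto
  obtain nB PB where B: "nB > 0" "\<And>s::int. of_int nB * poly B (t + of_int s) = of_int (poly PB s)"
    by (rule shifted_poly_clear_denominators[of B t]) auto
  obtain na Pa where Pa: "na > 0" "\<And>s::int. of_int na * poly ?a (t + of_int s) = of_int (poly Pa s)"
    by (rule shifted_poly_clear_denominators[of ?a t]) auto
  obtain nb Pb where Pb: "nb > 0" "\<And>s::int. of_int nb * poly ?b (t + of_int s) = of_int (poly Pb s)"
    by (rule shifted_poly_clear_denominators[of ?b t]) auto
  \<comment> \<open>The duplication relation is homogeneous of degree 4 in the coordinates and
    \<open>a\<close>, \<open>b\<close>, so scaling all by \<open>l\<close> makes the values of
    \<open>a\<close> and \<open>b\<close> integers. At \<open>t + s\<close> the scaled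
    \<open>X 0\<close> is then \<open>u(s) / w(s)\<close>.\<close>
  define l where "l = na * nb"
  have l: "l > 0" using Pa Pb by (simp add: l_def)
  define u w where "u = smult (l * nB) PA" and "w = smult nA PB"
  have u0: "poly u 0 \<noteq> 0" using A(2)[of 0] A(1) B(1) l X0(3) by (auto simp: u_def)
  have w0: "poly w 0 = 0" using B(2)[of 0] X0(4) by (auto simp: w_def)
  \<comment> \<open>The roots of \<open>Z\<close> are the points to avoid: zeros of the denominator
    of \<open>X 0\<close>, and bad fibres. Only finitely many \<open>k\<close> hit them, and taking
    \<open>k\<close> above \<open>|poly u 0|\<close> also ensures
    \<open>|poly u 0| < 2^k\<close>.\<close>
  define Z where "Z = B * ?a * ?b * (?a - ?b)"
  have ab: "?a \<noteq> 0" "?b \<noteq> 0" "?a - ?b \<noteq> 0"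
  proof -
    have "a \<noteq> 0" "b \<noteq> 0" "a \<noteq> b" using good_fibre by (auto simp: a_def b_def)
    then show "?a \<noteq> 0" "?b \<noteq> 0" "?a - ?b \<noteq> 0"
      using map_poly_of_int_inj[of _ 0] map_poly_of_int_inj[of a b] by auto
  qed
  then have "Z \<noteq> 0" using X0(2) by (simp add: Z_def)
  then have "finite {s. poly Z s = 0}" by (rule poly_roots_finite)
  then have "finite ((\<lambda>k. t + of_int (2 ^ k)) -` {s. poly Z s = 0} :: nat set)"
    by (rule finite_vimageI) (simp add: inj_def)
  then have "finite ((\<lambda>k. t + of_int (2 ^ k)) -` {s. poly Z s = 0} \<union> {..nat \<bar>poly u 0\<bar>})" by simp
  then obtain k where "k \<notin> (\<lambda>k. t + of_int (2 ^ k)) -` {s. poly Z s = 0} \<union> {..nat \<bar>poly u 0\<bar>}"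
    using ex_new_if_finite[OF infinite_UNIV_nat] by blast
  then have Zk: "poly Z (t + of_int (2 ^ k)) \<noteq> 0" and k: "nat \<bar>poly u 0\<bar> < k" by auto
  define t1 where "t1 = t + of_int (2 ^ k)"
  have nz: "poly B t1 \<noteq> 0" "poly ?a t1 \<noteq> 0" "poly ?b t1 \<noteq> 0" "poly ?a t1 \<noteq> poly ?b t1"
    using Zk unfolding Z_def t1_def[symmetric] by auto
  \<comment> \<open>One choice of \<open>t1\<close> serves the whole sequence, because regularity of
    \<open>X 0\<close> passes to all later halves.\<close>
  have reg: "\<not> rf_has_pole (X n) t1" for n
  proof (induction n)
    case 0
    then show ?case using X0(1) nz(1) rf_regularI by simp
  next
    case (Suc n)
    then show ?case by (intro rf_regular_half[OF _ _ Suc rel]) (simp_all add: rf_regular_ipoly)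
  qed
  define \<alpha> \<beta> where "\<alpha> = nb * poly Pa (2 ^ k)" and "\<beta> = na * poly Pb (2 ^ k)"
  have \<alpha>: "of_int \<alpha> = of_int l * poly ?a t1"
    using Pa(2)[of "2 ^ k"] by (simp add: \<alpha>_def l_def t1_def ac_simps)
  have \<beta>: "of_int \<beta> = of_int l * poly ?b t1"
    using Pb(2)[of "2 ^ k"] by (simp add: \<beta>_def l_def t1_def ac_simps)
  define g where "g = (\<lambda>n. of_int l * rf_eval (X n) t1)"
  have g: "((g (Suc n))\<^sup>2 - of_int \<alpha> * of_int \<beta>)\<^sup>2 =
      4 * g n * g (Suc n) * (g (Suc n) - of_int \<alpha>) * (g (Suc n) - of_int \<beta>)" for n
  proof -
    define z z' where "z = rf_eval (X n) t1" and "z' = rf_eval (X (Suc n)) t1"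
    have "(z'\<^sup>2 - poly ?a t1 * poly ?b t1)\<^sup>2 = 4 * z * z' * (z' - poly ?a t1) * (z' - poly ?b t1)"
      using arg_cong[OF rel[of n], of "\<lambda>f. rf_eval f t1"] reg[of n] reg[of "Suc n"]
      by (simp add: rf_regular_simps rf_regular_ipoly z_def z'_def ipoly_eval_def)
    then show ?thesis unfolding g_def \<alpha> \<beta> z_def[symmetric] z'_def[symmetric] by algebra
  qed
  have "g 0 = of_int (poly u (2 ^ k)) / of_int (poly w (2 ^ k))"
  proof -
    have "rf_eval (X 0) t1 = poly A t1 / poly B t1" unfolding X0(1) using nz(1) by (rule rf_eval_Fract)
    moreover have "of_int (poly u (2 ^ k)) = of_int (l * nB * nA) * poly A t1"
      using A(2)[of "2 ^ k"] by (simp add: u_def t1_def ac_simps)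
    moreover have "of_int (poly w (2 ^ k)) = of_int (nB * nA) * poly B t1"
      using B(2)[of "2 ^ k"] by (simp add: w_def t1_def ac_simps)
    ultimately show ?thesis using A(1) B(1) by (simp add: g_def)
  qed
  moreover have "poly w (2 ^ k) \<noteq> 0"
  proof
    assume "poly w (2 ^ k) = 0"
    then have "of_int nB * poly B t1 = 0" using B(2)[of "2 ^ k"] A(1) by (simp add: w_def t1_def)
    then show False using B(1) nz(1) by simp
  qed
  moreover have "\<bar>poly u 0\<bar> < 2 ^ k"
  proof -
    have "\<bar>poly u 0\<bar> < int k" using k by linarith
    also have "\<dots> < 2 ^ k" using of_nat_less_two_power by blast
    finally show ?thesis .
  qed
  ultimately obtain m where "m > 0" "two_adic_pole m (g 0)"
    using two_adic_pole_quotient[OF u0 w0] by metis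
  moreover have "\<alpha> \<noteq> 0" "\<beta> \<noteq> 0" "\<alpha> \<noteq> \<beta>" using \<alpha> \<beta> nz l by auto
  ultimately show False using no_infinite_halving[of \<alpha> \<beta> g m] g by blast
qed

theorem theorem2p2:
  fixes e1 e2 e3 :: "int poly" and t0 :: rat
  assumes distinct: "e1 \<noteq> e2" "e2 \<noteq> e3" "e1 \<noteq> e3"
    and nonconstant: "\<not> legendre_constant e1 e2 e3"
    and good_fibre: "ipoly_eval e1 t0 \<noteq> ipoly_eval e2 t0"
                    "ipoly_eval e2 t0 \<noteq> ipoly_eval e3 t0"
                    "ipoly_eval e1 t0 \<noteq> ipoly_eval e3 t0"
    and cond: "\<And>h. squarefree h \<Longrightarrow> degree h > 0 \<Longrightarrow>
                 h dvd (e1 - e2) * (e1 - e3) \<or> h dvd (e2 - e1) * (e2 - e3) \<or>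
                 h dvd (e3 - e1) * (e3 - e2) \<Longrightarrow>
                 \<not> (\<exists>q::rat. q^2 = ipoly_eval h t0)"
  shows "inj_on (specialize t0)
           (legendre_points (ipoly_to_rf e1) (ipoly_to_rf e2) (ipoly_to_rf e3))"
proof (rule inj_onI)
  let ?E1 = "ipoly_to_rf e1" and ?E2 = "ipoly_to_rf e2" and ?E3 = "ipoly_to_rf e3"
  fix P Q
  assume P: "P \<in> legendre_points ?E1 ?E2 ?E3" and Q: "Q \<in> legendre_points ?E1 ?E2 ?E3"
    and eq: "specialize t0 P = specialize t0 Q"
  \<comment> \<open>Hence only \<open>Infinity\<close> specializes to \<open>Infinity\<close>, and
    two affine points with equal image cannot differ, since their difference would have a
    pole.\<close>
  have no_pole: "\<not> rf_has_pole x t0" if "y\<^sup>2 = (x - ?E1) * (x - ?E2) * (x - ?E3)" for x y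
    using no_point_with_pole[OF good_fibre cond that] by blast
  show "P = Q"
  proof (cases P)
    case Infinity
    then show ?thesis using Q eq no_pole by (cases Q) (auto simp: legendre_points_def)
  next
    case 1: (Affine x1 y1)
    then have c1: "y1\<^sup>2 = (x1 - ?E1) * (x1 - ?E2) * (x1 - ?E3)"
      using P by (simp add: legendre_points_def)
    note r1 = no_pole[OF c1]
    show ?thesis
    proof (cases Q)
      case Infinity
      then show ?thesis using 1 r1 eq by simp
    next
      case 2: (Affine x2 y2)
      then have c2: "y2\<^sup>2 = (x2 - ?E1) * (x2 - ?E2) * (x2 - ?E3)"
        using Q by (simp add: legendre_points_def)
      note r2 = no_pole[OF c2]
      have ev: "rf_eval x1 t0 = rf_eval x2 t0" "rf_eval y1 t0 = rf_eval y2 t0"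
        using eq 1 2 r1 r2 by simp_all
      show ?thesis
      proof (rule ccontr)
        assume "P \<noteq> Q"
        then have "x1 \<noteq> x2 \<or> y1 \<noteq> y2" using 1 2 by auto
        then have "\<exists>x y. y\<^sup>2 = (x - ?E1) * (x - ?E2) * (x - ?E3) \<and> rf_has_pole x t0"
          using c1 c2 r1 r2 ev good_fibre
          by (intro exists_difference_with_pole[of _ t0 _ _ y1 x1 y2 x2])
            (simp_all add: rf_regular_ipoly)
        then show False using no_pole by blast
      qed
    qed
  qed
qed

end
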